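(* Let $I\subseteq\mathbb R$ be a nondegenerate interval, and let $\mathcal D^{lc}(I)$, $\mathcal D^{lc}_0(I)$ consist of functions that are Henstock--Kurzweil integrable on $I$. Then: (a) $\mathcal D^{lc}(I)$ and $\mathcal D^{lc}_0(I)$ are ordered normed spaces with respect to the Alexiewicz norm $\|F\|_A=\sup_{[a,b]\subseteq I}\left|\int_a^bF(t)\,dt\right|$ and the pointwise order. (b) $\mathcal A_D(I)$ is an ordered normed space with respect to the partial order $f\preceq g \iff \mathcal F(f)\le\mathcal F(g)$ (pointwise) and the norm $\|f\|_A=\|\mathcal F(f)\|_A$, where $\mathcal F(f)$ is the primitive of $f$ in $\mathcal D^{lc}_0(I)$. (c) $\mathcal A_D(I)$ and $\mathcal D^{lc}_0(I)$ are isometrically isomorphic, the integral, i.e. the map $f\mapsto\mathcal F(f)$, providing a linear isometry.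
   Context: Distributions: $\mathcal D$ is the space of test functions on $I$, i.e. infinitely differentiable functions $\varphi:\mathbb R\to\mathbb R$ whose support is a compact subset of $I$; $\varphi_n\to\varphi$ in $\mathcal D$ means that there is a compact $K\subseteq I$ containing all supports of the $\varphi_n$ and that $\varphi_n^{(m)}\to\varphi^{(m)}$ uniformly on $K$ for every $m\ge 0$. $\mathcal D'$ is the space of (sequentially) continuous linear functionals on $\mathcal D$, and $\langle T',\varphi\rangle=-\langle T,\varphi'\rangle$. An $HK$ integrable function $H$ is identified with the distribution $\varphi\mapsto\int_I H(t)\varphi(t)\,dt$. A function $H:I\to\mathbb R$ is left regulated if it has a finite left limit at each point of $I$ except the possible minimum of $I$. $H(\inf I+)$ is the (finite) limit of $H(t)$ as $t\to\inf I$ from the right (as $t\to-\infty$ if $\inf I=-\infty$). In this statement: - $\mathcal D^{lc}(I)$ is the set of all $G:I\to\mathbb R$ that are left regulated, $HK$ integrable on $I$, have a right limit at $\inf I$, are left continuous at every point of $I$ other than the possible minimum, and satisfy $G(\min I)=G(\min I+)$ if $\min I$ exists; - $\mathcal D^{lc}_0(I)=\{F\in\mathcal D^{lc}(I): F(\inf I+)=0\}$; - $\mathcal A_D(I)$ is the set of distributions $f\in\mathcal D'$ such that $f=F'$ (distributional derivative) for some $F\in\mathcal D^{lc}_0(I)$; this $F$ is unique and is denoted $\mathcal F(f)$. An ordered vector space is a real vector space $E$ with a partial order $\preceq$ such that $x\preceq y$ implies $x+z\preceq y+z$ and $kx\preceq ky$ for all $z\in E$, $k\ge 0$. A vector space with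 such a partial order and with a norm is an ordered normed space if the cone $E_+=\{x\in E: x\succeq 0\}$ is closed in the norm topology.
   Formalization: In the convergence φ_n→φ in 𝒟, the compact set K is also required to contain the support of the limit φ; otherwise K=∅ and φ_n=0 would converge to every φ, so that 𝒟'={0} and (c) would fail. *)

theory Defs
  imports "HOL-Analysis.Analysis" "HOL-Library.Function_Algebras"
begin

section \<open>Spaces of real functions and of functionals as real vector spaces\<close>

text \<open>\<open>HOL-Library.Function_Algebras\<close> provides the pointwise additive structure; pointwise scalar
  multiplication makes every type of vector-valued functions a real vector space.\<close>

instantiation "fun" :: (type, real_vector) real_vector
begin

definition scaleR_fun :: "real \<Rightarrow> ('a \<Rightarrow> 'b) \<Rightarrow> 'a \<Rightarrow> 'b"
  where "scaleR_fun c f = (\<lambda>x. c *\<^sub>R f x)"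

instance
  by standard (auto simp: scaleR_fun_def fun_eq_iff scaleR_add_right scaleR_add_left)

end

lemma scaleR_fun_apply [simp]: "(c *\<^sub>R f) x = c *\<^sub>R f x"
  by (simp add: scaleR_fun_def)


section \<open>Ordered normed spaces\<close>

text \<open>Ordered vector spaces and normed spaces are linear subspaces \<open>E\<close> of a type of class
  \<open>real_vector\<close>; the order and the norm only matter on \<open>E\<close>.\<close>

locale ordered_vector_space_on =
  fixes E :: "'a::real_vector set"
    and le :: "'a \<Rightarrow> 'a \<Rightarrow> bool"  (infix \<open>\<preceq>\<close> 50)
  assumes subspace: "subspace E"
    and le_refl: "reflp_on E (\<preceq>)"
    and le_antisym: "antisymp_on E (\<preceq>)"
    and le_trans: "transp_on E (\<preceq>)"
    and le_add_right: "\<lbrakk>x \<in> E; y \<in> E; z \<in> E; x \<preceq> y\<rbrakk> \<Longrightarrow> x + z \<preceq> y + z"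
    and le_scaleR: "\<lbrakk>x \<in> E; y \<in> E; 0 \<le> k; x \<preceq> y\<rbrakk> \<Longrightarrow> k *\<^sub>R x \<preceq> k *\<^sub>R y"
begin

definition cone :: "'a set"
  where "cone = {x \<in> E. 0 \<preceq> x}"

end

locale normed_space_on =
  fixes E :: "'a::real_vector set"
    and nrm :: "'a \<Rightarrow> real"
  assumes linear_subspace: "subspace E"
    and nrm_nonneg: "x \<in> E \<Longrightarrow> 0 \<le> nrm x"
    and nrm_eq_0_iff: "x \<in> E \<Longrightarrow> nrm x = 0 \<longleftrightarrow> x = 0"
    and nrm_triangle: "\<lbrakk>x \<in> E; y \<in> E\<rbrakk> \<Longrightarrow> nrm (x + y) \<le> nrm x + nrm y"
    and nrm_scaleR: "x \<in> E \<Longrightarrow> nrm (k *\<^sub>R x) = \<bar>k\<bar> * nrm x"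
begin

text \<open>The locale \<open>Metric_space\<close> requires nonnegativity and symmetry of the distance also for
  arguments outside the carrier, hence the case distinction.\<close>

definition nrm_dist :: "'a \<Rightarrow> 'a \<Rightarrow> real"
  where "nrm_dist x y = (if x \<in> E \<and> y \<in> E then nrm (x - y) else 0)"

definition nrm_topology :: "'a topology"
  where "nrm_topology = Metric_space.mtopology E nrm_dist"

lemma Metric_space_nrm_dist: "Metric_space E nrm_dist"
proof
  fix x y z
  have diff: "x - y \<in> E" if "x \<in> E" "y \<in> E" for x y
    using linear_subspace that by (rule subspace_diff)
  show "0 \<le> nrm_dist x y"
    by (simp add: nrm_dist_def nrm_nonneg diff)
  have "nrm (x - y) = nrm (y - x)" if "x \<in> E" "y \<in> E"
    using nrm_scaleR[OF diff[OF that], of "-1"] by simp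
  then show "nrm_dist x y = nrm_dist y x"
    by (simp add: nrm_dist_def)
  show "nrm_dist x y = 0 \<longleftrightarrow> x = y" if "x \<in> E" "y \<in> E"
    using that by (simp add: nrm_dist_def nrm_eq_0_iff diff)
  show "nrm_dist x z \<le> nrm_dist x y + nrm_dist y z" if "x \<in> E" "y \<in> E" "z \<in> E"
    using that nrm_triangle[of "x - y" "y - z"] by (simp add: nrm_dist_def diff)
qed

end

locale ordered_normed_space_on =
  ordered_vector_space_on E le + normed_space_on E nrm
  for E :: "'a::real_vector set" and le :: "'a \<Rightarrow> 'a \<Rightarrow> bool" and nrm :: "'a \<Rightarrow> real" +
  assumes closedin_cone: "closedin nrm_topology cone"

definition linear_isometry_between ::
  "'a::real_vector set \<Rightarrow> ('a \<Rightarrow> real) \<Rightarrow> 'b::real_vector set \<Rightarrow> ('b \<Rightarrow> real) \<Rightarrow> ('a \<Rightarrow> 'b) \<Rightarrow> bool"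
  where "linear_isometry_between V nrmV W nrmW h \<longleftrightarrow>
    bij_betw h V W \<and>
    (\<forall>x\<in>V. \<forall>y\<in>V. h (x + y) = h x + h y) \<and>
    (\<forall>c. \<forall>x\<in>V. h (c *\<^sub>R x) = c *\<^sub>R h x) \<and>
    (\<forall>x\<in>V. nrmW (h x) = nrmV x)"


section \<open>Left continuous functions on an interval\<close>

text \<open>A function \<open>I \<rightarrow> \<real>\<close> is represented by its extension by \<open>0\<close> to the whole line, so that
  functions on \<open>I\<close> form a linear subspace of \<open>real \<Rightarrow> real\<close> and equality is equality on \<open>I\<close>.\<close>

definition functions_on :: "real set \<Rightarrow> (real \<Rightarrow> real) set"
  where "functions_on I = {G. \<forall>t. t \<notin> I \<longrightarrow> G t = 0}"

definition is_min :: "real set \<Rightarrow> real \<Rightarrow> bool"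
  where "is_min I m \<longleftrightarrow> m \<in> I \<and> (\<forall>t\<in>I. m \<le> t)"

text \<open>The filter of \<open>t \<rightarrow> inf I\<close> from the right.\<close>

definition inf_right :: "real set \<Rightarrow> real filter"
  where "inf_right I = (if bdd_below I then at_right (Inf I) else at_bot)"

definition left_regulated :: "real set \<Rightarrow> (real \<Rightarrow> real) \<Rightarrow> bool"
  where "left_regulated I H \<longleftrightarrow> (\<forall>t\<in>I. \<not> is_min I t \<longrightarrow> (\<exists>l. (H \<longlongrightarrow> l) (at_left t)))"

definition Dlc :: "real set \<Rightarrow> (real \<Rightarrow> real) set"
  where "Dlc I = {G \<in> functions_on I.
    left_regulated I G \<and>
    G integrable_on I \<and>
    (\<exists>l. (G \<longlongrightarrow> l) (inf_right I)) \<and>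
    (\<forall>t\<in>I. \<not> is_min I t \<longrightarrow> continuous (at_left t) G) \<and>
    (\<forall>m. is_min I m \<longrightarrow> (G \<longlongrightarrow> G m) (at_right m))}"

definition Dlc0 :: "real set \<Rightarrow> (real \<Rightarrow> real) set"
  where "Dlc0 I = {F \<in> Dlc I. (F \<longlongrightarrow> 0) (inf_right I)}"

definition pointwise_le :: "real set \<Rightarrow> (real \<Rightarrow> real) \<Rightarrow> (real \<Rightarrow> real) \<Rightarrow> bool"
  where "pointwise_le I F G \<longleftrightarrow> (\<forall>t\<in>I. F t \<le> G t)"

definition alexiewicz_norm :: "real set \<Rightarrow> (real \<Rightarrow> real) \<Rightarrow> real"
  where "alexiewicz_norm I F =
    (SUP (a, b) \<in> {(a, b). a \<le> b \<and> {a..b} \<subseteq> I}. \<bar>integral {a..b} F\<bar>)"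

text \<open>The supremum is over a bounded set, so it is not the arbitrary value of an unbounded \<open>Sup\<close>.\<close>

lemma bdd_above_alexiewicz:
  fixes F :: "real \<Rightarrow> real"
  assumes "F integrable_on I"
  shows "bdd_above ((\<lambda>(a, b). \<bar>integral {a..b} F\<bar>) ` {(a, b). a \<le> b \<and> {a..b} \<subseteq> I})"
proof -
  define G where "G t = (if t \<in> I then F t else 0)" for t
  obtain i where "(G has_integral i) UNIV"
    using assms unfolding G_def integrable_on_def has_integral_restrict_UNIV by blast
  then have *: "(\<forall>a b. G integrable_on {a..b}) \<and>
      (\<forall>e>0. \<exists>B>0. \<forall>a b. ball 0 B \<subseteq> {a..b} \<longrightarrow> \<bar>integral {a..b} G - i\<bar> < e)"
    by (subst (asm) has_integral_alt') simp
  then have G: "\<And>a b. G integrable_on {a..b}"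
    and "\<exists>B>0. \<forall>a b. ball 0 B \<subseteq> {a..b} \<longrightarrow> \<bar>integral {a..b} G - i\<bar> < 1"
    by auto
  then obtain B where B: "B > 0"
    "\<And>a b. ball 0 B \<subseteq> {a..b} \<Longrightarrow> \<bar>integral {a..b} G - i\<bar> < 1" by auto
  define P where "P x = integral {-B..x} G" for x
  obtain C where C: "\<And>x. x \<in> {-B..B} \<Longrightarrow> \<bar>P x\<bar> \<le> C"
  proof -
    have "continuous_on {-B..B} P"
      unfolding P_def by (rule indefinite_integral_continuous_1[OF G])
    then have "bounded (P ` {-B..B})"
      by (intro compact_imp_bounded compact_continuous_image) auto
    then obtain a where "\<forall>y\<in>P ` {-B..B}. \<bar>y\<bar> \<le> a"
      unfolding bounded_iff by auto
    then show thesis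
      by (intro that[of a]) blast
  qed
  have C0: "0 \<le> C"
    using C[of B] B(1) by simp
  have comb: "integral {a..c} G + integral {c..b} G = integral {a..b} G"
    if "a \<le> c" "c \<le> b" for a b c
    by (rule Henstock_Kurzweil_Integration.integral_combine[OF that G])
  have ball: "\<bar>integral {a..b} G\<bar> \<le> \<bar>i\<bar> + 1" if "a \<le> -B" "B \<le> b" for a b
  proof -
    have "ball 0 B \<subseteq> {a..b}"
      using that by (auto simp: dist_real_def)
    from B(2)[OF this] show ?thesis by linarith
  qed
  have right: "\<bar>integral {-B..x} G\<bar> \<le> C + \<bar>i\<bar> + 1" if "-B \<le> x" for x
  proof (cases "x \<le> B")
    case True
    then show ?thesis using C[of x] that by (simp add: P_def)
  next
    case False
    then show ?thesis using ball[of "-B" x] C0 by simp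
  qed
  have left: "\<bar>integral {x..-B} G\<bar> \<le> C + \<bar>i\<bar> + 1" if "x \<le> -B" for x
    using ball[of x B] comb[of x "-B" B] that C[of B] B(1) by (simp add: P_def)
  have bound: "\<bar>integral {a..b} G\<bar> \<le> 2 * (C + \<bar>i\<bar> + 1)" if "a \<le> b" for a b
  proof -
    consider "b \<le> -B" | "a \<le> -B" "-B \<le> b" | "-B \<le> a" by linarith
    then show ?thesis
    proof cases
      case 1
      then show ?thesis
        using left[of a] left[of b] comb[of a b "-B"] that by simp
    next
      case 2
      then show ?thesis
        using left[of a] right[of b] comb[of a "-B" b] by simp
    next
      case 3
      then show ?thesis
        using right[of a] right[of b] comb[of "-B" a b] that by simp
    qed
  qed
  have "integral {a..b} F = integral {a..b} G" if "{a..b} \<subseteq> I" for a b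
    using that by (intro integral_cong) (auto simp: G_def)
  with bound show ?thesis
    by (intro bdd_aboveI[where M = "2 * (C + \<bar>i\<bar> + 1)"]) auto
qed


section \<open>Distributions\<close>

abbreviation supp :: "(real \<Rightarrow> real) \<Rightarrow> real set"
  where "supp \<phi> \<equiv> closure (support_on UNIV \<phi>)"

definition test_functions :: "real set \<Rightarrow> (real \<Rightarrow> real) set"
  where "test_functions I = {\<phi>.
    (\<forall>m x. (deriv ^^ m) \<phi> differentiable at x) \<and> compact (supp \<phi>) \<and> supp \<phi> \<subseteq> I}"

text \<open>The compact set \<open>K\<close> is also required to contain the support of the limit, which makes
  the convergence on \<open>K\<close> uniform on the whole line. Otherwise limits would not be unique (take
  \<open>K = {}\<close> and \<open>\<Phi> n = 0\<close>).\<close>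

definition test_tendsto :: "real set \<Rightarrow> (nat \<Rightarrow> real \<Rightarrow> real) \<Rightarrow> (real \<Rightarrow> real) \<Rightarrow> bool"
  where "test_tendsto I \<Phi> \<phi> \<longleftrightarrow> (\<exists>K. compact K \<and> K \<subseteq> I \<and> (\<forall>n. supp (\<Phi> n) \<subseteq> K) \<and> supp \<phi> \<subseteq> K \<and>
    (\<forall>m. uniform_limit K (\<lambda>n. (deriv ^^ m) (\<Phi> n)) ((deriv ^^ m) \<phi>) sequentially))"

text \<open>Functionals on the test functions are extended by \<open>0\<close> to all of \<open>real \<Rightarrow> real\<close>, so that
  distributions form a linear subspace and equality is equality on the test functions.\<close>

definition distributions :: "real set \<Rightarrow> ((real \<Rightarrow> real) \<Rightarrow> real) set"
  where "distributions I = {T.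
    (\<forall>\<phi>. \<phi> \<notin> test_functions I \<longrightarrow> T \<phi> = 0) \<and>
    (\<forall>\<phi>\<in>test_functions I. \<forall>\<psi>\<in>test_functions I. T (\<phi> + \<psi>) = T \<phi> + T \<psi>) \<and>
    (\<forall>c. \<forall>\<phi>\<in>test_functions I. T (c *\<^sub>R \<phi>) = c * T \<phi>) \<and>
    (\<forall>\<Phi> \<phi>. range \<Phi> \<subseteq> test_functions I \<longrightarrow> \<phi> \<in> test_functions I \<longrightarrow> test_tendsto I \<Phi> \<phi> \<longrightarrow>
      (\<lambda>n. T (\<Phi> n)) \<longlonglongrightarrow> T \<phi>)}"

definition distr_of :: "real set \<Rightarrow> (real \<Rightarrow> real) \<Rightarrow> (real \<Rightarrow> real) \<Rightarrow> real"
  where "distr_of I H =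
    (\<lambda>\<phi>. if \<phi> \<in> test_functions I then integral I (\<lambda>t. H t * \<phi> t) else 0)"

definition distr_deriv :: "real set \<Rightarrow> ((real \<Rightarrow> real) \<Rightarrow> real) \<Rightarrow> (real \<Rightarrow> real) \<Rightarrow> real"
  where "distr_deriv I T = (\<lambda>\<phi>. if \<phi> \<in> test_functions I then - T (deriv \<phi>) else 0)"

definition AD :: "real set \<Rightarrow> ((real \<Rightarrow> real) \<Rightarrow> real) set"
  where "AD I = {f \<in> distributions I. \<exists>F\<in>Dlc0 I. f = distr_deriv I (distr_of I F)}"

definition primitive :: "real set \<Rightarrow> ((real \<Rightarrow> real) \<Rightarrow> real) \<Rightarrow> real \<Rightarrow> real"
  where "primitive I f = (THE F. F \<in> Dlc0 I \<and> f = distr_deriv I (distr_of I F))"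

definition AD_le :: "real set \<Rightarrow> ((real \<Rightarrow> real) \<Rightarrow> real) \<Rightarrow> ((real \<Rightarrow> real) \<Rightarrow> real) \<Rightarrow> bool"
  where "AD_le I f g \<longleftrightarrow> pointwise_le I (primitive I f) (primitive I g)"

definition AD_norm :: "real set \<Rightarrow> ((real \<Rightarrow> real) \<Rightarrow> real) \<Rightarrow> real"
  where "AD_norm I f = alexiewicz_norm I (primitive I f)"

end

theory Submission
  imports Defs "HOL-Computational_Algebra.Polynomial"
begin

text \<open>Write \<open>F'\<close> for the distributional derivative of \<open>F\<close>. Two observations carry everything.

  First, a function that is left continuous away from the minimum of \<open>I\<close>, and right continuous
  there, can be read off from its integrals: if \<open>G t < 0\<close> at a point \<open>t\<close>, then \<open>G\<close> stays below
  \<open>G t / 2\<close> on a short interval \<open>[u, t]\<close>, and the integral over it is negative. Hence \<open>G \<ge> 0\<close> as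
  soon as all integrals over compact subintervals are nonnegative
  (\<open>Dlc_nonneg_of_integrals\<close>). Applied to \<open>G\<close> and \<open>-G\<close>, this makes the Alexiewicz seminorm
  definite. It also closes the cone: if \<open>F\<close> is not nonnegative, some integral of \<open>F\<close> equals
  \<open>-r < 0\<close>, so every nonnegative function is at distance at least \<open>r\<close> from \<open>F\<close>. This is part (a)
  for any linear subspace of \<open>Dlc I\<close>.

  Second, \<open>F \<mapsto> F'\<close> is a linear bijection from \<open>Dlc0 I\<close> onto \<open>AD I\<close>, and \<open>primitive I\<close> is its
  inverse. Parts (b) and (c) then follow because the order and the norm of \<open>AD I\<close> are
  by definition pulled back along \<open>primitive I\<close>
  (\<open>ordered_normed_space_on_linear_pullback\<close>). Two points need proof.

  \<^item> \<open>F'\<close> is a distribution. A function \<open>F\<close> in \<open>Dlc0 I\<close> may be unbounded, and not absolutely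
    integrable, so neither the existence of \<open>\<integral> F \<phi>\<close> nor its continuity in \<open>\<phi>\<close> is
    obvious. Both come from integration by parts for the Henstock--Kurzweil integral
    (\<open>has_integral_by_parts_primitive\<close>), which replaces \<open>F\<close> by its continuous primitive \<open>P\<close>
    and \<open>\<phi>\<close> by its derivative; it rests on Henstock's lemma, since \<open>P\<close> need not be
    differentiable everywhere.

  \<^item> \<open>F' = 0\<close> implies \<open>F = 0\<close> for \<open>F\<close> in \<open>Dlc0 I\<close>, as in the lemma of du Bois-Reymond. For two
    points \<open>s\<close>, \<open>t\<close> other than the minimum, the difference of two smooth steps that rise from
    \<open>0\<close> to \<open>1\<close> just before \<open>s\<close> and just before \<open>t\<close> is a test function. Its derivative is the
    difference of two unit masses concentrated to the left of \<open>s\<close> and of \<open>t\<close>, so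
    left continuity yields \<open>F s = F t\<close>. The constant value is the limit at \<open>inf I\<close>, which is \<open>0\<close>.\<close>

hide_const (open) Polynomial.content

section \<open>Integration by parts for the Henstock--Kurzweil integral\<close>

text \<open>The fundamental theorem of calculus is not applicable to \<open>P * g\<close>, where \<open>P x = \<integral>\<^sub>a\<^sup>x F\<close>, because
  \<open>P\<close> may fail to be differentiable on an uncountable null set. Instead, the increment of
  \<open>P * g\<close> over an interval \<open>[u, v]\<close> with tag \<open>x\<close> is compared with the Riemann term directly. The
  part \<open>g x * (P v - P u - F x * (v - u))\<close> of the error is controlled in total by Henstock's lemma
  and a bound of \<open>g\<close>; the rest is at most \<open>e2 * (v - u)\<close> by continuity of \<open>P\<close> and
  differentiability of \<open>g\<close> at \<open>x\<close>.\<close>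

lemma has_integral_by_parts_primitive:
  fixes F g g' :: "real \<Rightarrow> real"
  assumes "a \<le> b"
    and F: "F integrable_on {a..b}"
    and g: "\<And>x. x \<in> {a..b} \<Longrightarrow> (g has_real_derivative g' x) (at x within {a..b})"
  shows "((\<lambda>x. F x * g x + integral {a..x} F * g' x) has_integral
    integral {a..b} F * g b) {a..b}"
proof -
  define P where "P x = integral {a..x} F" for x
  have P_cont: "continuous_on {a..b} P"
    unfolding P_def by (rule indefinite_integral_continuous_1[OF F])
  have g_cont: "continuous_on {a..b} g"
    using g by (rule DERIV_continuous_on)
  obtain M where M: "M > 0" "\<And>x. x \<in> {a..b} \<Longrightarrow> \<bar>g x\<bar> \<le> M"
  proof -
    have "bounded (g ` {a..b})"
      by (intro compact_imp_bounded compact_continuous_image g_cont) auto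
    then show thesis
      using that unfolding bounded_pos by auto
  qed
  have "((\<lambda>x. F x * g x + P x * g' x) has_integral P b * g b) (cbox a b)"
    unfolding has_integral
  proof (intro allI impI)
    fix e :: real assume "e > 0"
    \<comment> \<open>The two parts of the error contribute at most \<open>M * e1 = e / 2\<close> and \<open>e2 * (b - a) \<le> e / 4\<close>.\<close>
    define e1 where "e1 = e / (2 * M)"
    define e2 where "e2 = e / 4 / (b - a + 1)"
    have e12: "e1 > 0" "e2 > 0"
      using \<open>e > 0\<close> M(1) \<open>a \<le> b\<close> by (auto simp: e1_def e2_def)
    have F': "F integrable_on cbox a b" using F by simp
    from Henstock_lemma[OF F' e12(1)] obtain \<gamma> where \<gamma>: "gauge \<gamma>"
      "\<And>p. \<lbrakk>p tagged_partial_division_of (cbox a b); \<gamma> fine p\<rbrakk> \<Longrightarrow>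
         (\<Sum>(x,k)\<in>p. norm (content k *\<^sub>R F x - integral k F)) < e1"
      by blast
    \<comment> \<open>With this tolerance at \<open>x\<close> for both \<open>P\<close> and \<open>g\<close>, the error terms on one half of an
      interval add up to at most \<open>w x * (\<bar>P x\<bar> + \<bar>g' x\<bar> + 1)\<close>, which is \<open>e2\<close>, times the length of that half.\<close>
    define w where "w x = e2 / (\<bar>P x\<bar> + \<bar>g' x\<bar> + 1)" for x
    have w: "w x > 0" for x
      unfolding w_def using e12 by (intro divide_pos_pos) auto
    \<comment> \<open>The cap \<open>1\<close> makes \<open>\<bar>g' x\<bar> + 1\<close> a bound of the difference quotients of \<open>g\<close> near \<open>x\<close>.\<close>
    have ex: "\<exists>d>0. x \<in> {a..b} \<longrightarrow> (\<forall>y\<in>{a..b}. \<bar>y - x\<bar> < d \<longrightarrow>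
        \<bar>g y - g x - (y - x) * g' x\<bar> \<le> min (w x) 1 * \<bar>y - x\<bar> \<and> \<bar>P y - P x\<bar> \<le> w x)" for x
    proof (cases "x \<in> {a..b}")
      case True
      have "(g has_derivative (\<lambda>h. h * g' x)) (at x within {a..b})"
        using g[OF True] unfolding has_field_derivative_def by (simp only: mult_commute_abs)
      moreover have "min (w x) 1 > 0" using w[of x] by simp
      ultimately obtain d1 where d1: "d1 > 0"
        "\<forall>y\<in>{a..b}. \<bar>y - x\<bar> < d1 \<longrightarrow> \<bar>g y - g x - (y - x) * g' x\<bar> \<le> min (w x) 1 * \<bar>y - x\<bar>"
        unfolding has_derivative_within_alt real_norm_def by blast
      obtain d2 where d2: "d2 > 0" "\<forall>y\<in>{a..b}. \<bar>y - x\<bar> < d2 \<longrightarrow> \<bar>P y - P x\<bar> < w x"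
        using P_cont True w[of x] unfolding continuous_on_iff dist_real_def by metis
      show ?thesis
        using d1 d2 by (intro exI[of _ "min d1 d2"]) (auto intro: less_imp_le)
    qed (auto intro: exI[of _ 1])
    obtain d where d: "\<And>x. d x > 0" and dd: "\<And>x y. x \<in> {a..b} \<Longrightarrow> y \<in> {a..b} \<Longrightarrow> \<bar>y - x\<bar> < d x \<Longrightarrow>
        \<bar>g y - g x - (y - x) * g' x\<bar> \<le> min (w x) 1 * \<bar>y - x\<bar> \<and> \<bar>P y - P x\<bar> \<le> w x"
      using ex by metis
    \<comment> \<open>The estimate on the part of a tagged interval on one side of its tag \<open>x\<close>; \<open>y\<close> is the endpoint.\<close>
    have half: "\<bar>P y * g y - P x * g x - (g x * (P y - P x) + (y - x) * (P x * g' x))\<bar> \<le> e2 * \<bar>y - x\<bar>"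
      if "x \<in> {a..b}" "y \<in> {a..b}" "\<bar>y - x\<bar> < d x" for x y
    proof -
      define r where "r = g y - g x - (y - x) * g' x"
      have r: "\<bar>r\<bar> \<le> w x * \<bar>y - x\<bar>" "\<bar>r\<bar> \<le> \<bar>y - x\<bar>" and PP: "\<bar>P y - P x\<bar> \<le> w x"
      proof -
        have "min (w x) 1 * \<bar>y - x\<bar> \<le> w x * \<bar>y - x\<bar>" "min (w x) 1 * \<bar>y - x\<bar> \<le> 1 * \<bar>y - x\<bar>"
          by (intro mult_right_mono; simp)+
        moreover have "\<bar>r\<bar> \<le> min (w x) 1 * \<bar>y - x\<bar>" "\<bar>P y - P x\<bar> \<le> w x"
          using dd[OF that] by (simp_all add: r_def)
        ultimately show "\<bar>r\<bar> \<le> w x * \<bar>y - x\<bar>" "\<bar>r\<bar> \<le> \<bar>y - x\<bar>" "\<bar>P y - P x\<bar> \<le> w x"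
          by auto
      qed
      have "\<bar>g y - g x\<bar> \<le> (\<bar>g' x\<bar> + 1) * \<bar>y - x\<bar>"
      proof -
        have "\<bar>g y - g x\<bar> = \<bar>r + (y - x) * g' x\<bar>" by (simp add: r_def)
        also have "\<dots> \<le> \<bar>r\<bar> + \<bar>y - x\<bar> * \<bar>g' x\<bar>" by (metis abs_mult abs_triangle_ineq)
        finally show ?thesis using r(2) by (simp add: algebra_simps)
      qed
      with PP have 1: "\<bar>(P y - P x) * (g y - g x)\<bar> \<le> w x * ((\<bar>g' x\<bar> + 1) * \<bar>y - x\<bar>)"
        unfolding abs_mult using w[of x] by (intro mult_mono) auto
      have 2: "\<bar>P x * r\<bar> \<le> \<bar>P x\<bar> * (w x * \<bar>y - x\<bar>)"
        unfolding abs_mult using r(1) by (intro mult_left_mono) auto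
      have "P y * g y - P x * g x - (g x * (P y - P x) + (y - x) * (P x * g' x))
          = (P y - P x) * (g y - g x) + P x * r"
        by (simp add: r_def algebra_simps)
      also have "\<bar>\<dots>\<bar> \<le> w x * (\<bar>P x\<bar> + \<bar>g' x\<bar> + 1) * \<bar>y - x\<bar>"
        using 1 2 abs_triangle_ineq[of "(P y - P x) * (g y - g x)" "P x * r"]
        by (simp add: algebra_simps)
      also have "\<dots> = e2 * \<bar>y - x\<bar>"
        unfolding w_def by (simp add: add_nonneg_eq_0_iff)
      finally show ?thesis .
    qed
    define \<eta> where "\<eta> x = \<gamma> x \<inter> ball x (d x)" for x
    have gauge_eta: "gauge \<eta>"
      unfolding \<eta>_def using \<gamma>(1) d by (intro gauge_Int gauge_ball_dependent) auto
    have fine_eta: "norm ((\<Sum>(x,k)\<in>p. content k *\<^sub>R (F x * g x + P x * g' x)) - P b * g b) < e"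
      if p: "p tagged_division_of cbox a b" "\<eta> fine p" for p
    proof -
      have pd: "\<And>x K. (x, K) \<in> p \<Longrightarrow> x \<in> {a..b} \<and> (\<exists>u v. K = {u..v} \<and> u \<le> x \<and> x \<le> v \<and> a \<le> u \<and> v \<le> b \<and>
         \<bar>u - x\<bar> < d x \<and> \<bar>v - x\<bar> < d x)"
      proof -
        fix x K assume xK: "(x, K) \<in> p"
        obtain u v where uv: "K = {u..v}"
          using p(1) xK by (metis box_real(2) tagged_division_ofD(4))
        have K: "x \<in> K" "K \<subseteq> cbox a b" using p(1) xK by blast+
        have "K \<subseteq> ball x (d x)"
          using p(2) xK unfolding fine_def \<eta>_def by blast
        moreover have "u \<in> K" "v \<in> K" using K(1) uv by auto
        ultimately have "\<bar>u - x\<bar> < d x" "\<bar>v - x\<bar> < d x" "u \<in> cbox a b" "v \<in> cbox a b" "x \<in> cbox a b"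
          using K by (auto simp: dist_real_def subset_iff abs_minus_commute simp del: mem_box_real)
        then show "x \<in> {a..b} \<and> (\<exists>u v. K = {u..v} \<and> u \<le> x \<and> x \<le> v \<and> a \<le> u \<and> v \<le> b \<and>
         \<bar>u - x\<bar> < d x \<and> \<bar>v - x\<bar> < d x)"
          using uv K(1) by auto
      qed
      have tele: "(\<Sum>(x,K)\<in>p. P (Sup K) * g (Sup K) - P (Inf K) * g (Inf K)) = P b * g b"
        using additive_tagged_division_1[OF \<open>a \<le> b\<close>, of p "\<lambda>x. P x * g x"] p(1)
        by (simp add: P_def)
      have len: "(\<Sum>(x,K)\<in>p. Sup K - Inf K) = b - a"
        using additive_tagged_division_1[OF \<open>a \<le> b\<close>, of p "\<lambda>x. x"] p(1) by simp
      have "\<gamma> fine p"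
        using p(2) by (auto simp: fine_def \<eta>_def)
      then have hen: "(\<Sum>(x,K)\<in>p. \<bar>content K *\<^sub>R F x - integral K F\<bar>) < e1"
        using \<gamma>(2)[of p] p(1) by (simp add: tagged_division_of_def)
      have each: "\<bar>content K *\<^sub>R (F x * g x + P x * g' x) - (P (Sup K) * g (Sup K) - P (Inf K) * g (Inf K))\<bar>
          \<le> M * \<bar>content K *\<^sub>R F x - integral K F\<bar> + e2 * (Sup K - Inf K)" if xK: "(x, K) \<in> p" for x K
      proof -
        from pd[OF xK] obtain u v where uv: "x \<in> {a..b}" "K = {u..v}" "u \<le> x" "x \<le> v" "a \<le> u" "v \<le> b"
          "\<bar>u - x\<bar> < d x" "\<bar>v - x\<bar> < d x" by blast
        have K: "Sup K = v" "Inf K = u" "content K = v - u" using uv by auto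
        have int: "integral K F = P v - P u"
        proof -
          have "F integrable_on {a..v}"
            by (rule integrable_subinterval_real[OF F]) (use uv in auto)
          from Henstock_Kurzweil_Integration.integral_combine[OF _ _ this, of u]
          show ?thesis using uv by (simp add: P_def)
        qed
        have hu: "\<bar>P u * g u - P x * g x - (g x * (P u - P x) + (u - x) * (P x * g' x))\<bar> \<le> e2 * (x - u)"
          using half[of x u] uv by simp
        have hv: "\<bar>P v * g v - P x * g x - (g x * (P v - P x) + (v - x) * (P x * g' x))\<bar> \<le> e2 * (v - x)"
          using half[of x v] uv by simp
        have tri: "\<bar>p - q + r\<bar> \<le> \<bar>p\<bar> + \<bar>q\<bar> + \<bar>r\<bar>" for p q r :: real
          by linarith
        have eq: "content K *\<^sub>R (F x * g x + P x * g' x) - (P v * g v - P u * g u)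
          = g x * (content K *\<^sub>R F x - integral K F)
            - (P v * g v - P x * g x - (g x * (P v - P x) + (v - x) * (P x * g' x)))
            + (P u * g u - P x * g x - (g x * (P u - P x) + (u - x) * (P x * g' x)))"
          unfolding K int by (simp add: algebra_simps)
        have "\<bar>g x * (content K *\<^sub>R F x - integral K F)\<bar> \<le> M * \<bar>content K *\<^sub>R F x - integral K F\<bar>"
          unfolding abs_mult using M(2)[OF uv(1)] by (intro mult_right_mono) auto
        then have "\<bar>content K *\<^sub>R (F x * g x + P x * g' x) - (P v * g v - P u * g u)\<bar>
            \<le> M * \<bar>content K *\<^sub>R F x - integral K F\<bar> + e2 * (v - x) + e2 * (x - u)"
          unfolding eq using hu hv by (intro order_trans[OF tri] add_mono)
        also have "\<dots> = M * \<bar>content K *\<^sub>R F x - integral K F\<bar> + e2 * (Sup K - Inf K)"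
          unfolding K(1,2) by (simp add: algebra_simps)
        finally show ?thesis unfolding K(1,2) .
      qed
      define E where
        "E = (\<lambda>(x, K). content K *\<^sub>R (F x * g x + P x * g' x) - (P (Sup K) * g (Sup K) - P (Inf K) * g (Inf K)))"
      have "\<bar>sum E p\<bar> \<le> (\<Sum>(x,K)\<in>p. M * \<bar>content K *\<^sub>R F x - integral K F\<bar> + e2 * (Sup K - Inf K))"
      proof (rule order_trans[OF sum_abs sum_mono])
        fix z assume "z \<in> p"
        then show "\<bar>E z\<bar> \<le> (case z of (x, K) \<Rightarrow> M * \<bar>content K *\<^sub>R F x - integral K F\<bar> + e2 * (Sup K - Inf K))"
          using each by (cases z) (simp add: E_def)
      qed
      also have "\<dots> = M * (\<Sum>(x,K)\<in>p. \<bar>content K *\<^sub>R F x - integral K F\<bar>)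
          + e2 * (\<Sum>(x,K)\<in>p. Sup K - Inf K)"
        by (simp add: sum.distrib sum_distrib_left split_def)
      also have "\<dots> < M * e1 + e2 * (b - a + 1)"
        unfolding len by (intro add_less_le_mono mult_strict_left_mono[OF hen M(1)] mult_left_mono)
          (use e12 in simp_all)
      also have "\<dots> = e / 2 + e / 4"
      proof -
        have "b - a + 1 \<noteq> 0" using \<open>a \<le> b\<close> by linarith
        then have "e2 * (b - a + 1) = e / 4"
          unfolding e2_def by (rule nonzero_eq_divide_eq[THEN iffD1, OF _ refl])
        then show ?thesis using M(1) by (simp add: e1_def)
      qed
      also have "\<dots> < e"
        using \<open>e > 0\<close> by simp
      finally have "\<bar>sum E p\<bar> < e" .
      moreover have "(\<Sum>(x,k)\<in>p. content k *\<^sub>R (F x * g x + P x * g' x)) - P b * g b = sum E p"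
        unfolding tele[symmetric] E_def by (simp add: sum_subtractf split_def)
      ultimately show ?thesis by simp
    qed
    show "\<exists>\<gamma>. gauge \<gamma> \<and> (\<forall>p. p tagged_division_of cbox a b \<and> \<gamma> fine p \<longrightarrow>
      norm ((\<Sum>(x,k)\<in>p. content k *\<^sub>R (F x * g x + P x * g' x)) - P b * g b) < e)"
      by (intro exI[of _ \<eta>] conjI allI impI gauge_eta) (elim conjE, rule fine_eta)
  qed
  then show ?thesis by (simp add: P_def)
qed

text \<open>The right-hand side depends on \<open>g\<close> only through \<open>g b\<close> and an integral of the continuous function
  \<open>P * g'\<close>, so it is stable under pointwise convergence of \<open>g\<close> and uniform
  convergence of \<open>g'\<close>.\<close>

corollary has_integral_mult_C1:
  fixes F g g' :: "real \<Rightarrow> real"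
  assumes "a \<le> b"
    and F: "F integrable_on {a..b}"
    and g: "\<And>x. x \<in> {a..b} \<Longrightarrow> (g has_real_derivative g' x) (at x within {a..b})"
    and g': "continuous_on {a..b} g'"
  shows "((\<lambda>x. F x * g x) has_integral
    integral {a..b} F * g b - integral {a..b} (\<lambda>x. integral {a..x} F * g' x)) {a..b}"
proof -
  have "(\<lambda>x. integral {a..x} F * g' x) integrable_on {a..b}"
    by (intro integrable_continuous_real continuous_on_mult g' indefinite_integral_continuous_1 F)
  from has_integral_diff[OF has_integral_by_parts_primitive[OF assms(1-3)] integrable_integral[OF this]]
  show ?thesis by simp
qed

section \<open>Smooth functions\<close>

definition smooth :: "(real \<Rightarrow> real) \<Rightarrow> bool"
  where "smooth f \<longleftrightarrow> (\<forall>m x. (deriv ^^ m) f differentiable at x)"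

text \<open>Smoothness is the largest property that implies differentiability and passes to the derivative;
  this avoids formulas for higher derivatives in the closure properties below.\<close>

lemma smooth_coinduct:
  assumes "f \<in> S"
    and S: "\<And>g. g \<in> S \<Longrightarrow> (\<forall>x. g differentiable at x) \<and> deriv g \<in> S"
  shows "smooth f"
proof -
  have "(deriv ^^ m) f \<in> S" for m
    by (induction m) (use assms in auto)
  then show ?thesis
    using S by (simp add: smooth_def)
qed

lemma smooth_higher_deriv: "smooth f \<Longrightarrow> smooth ((deriv ^^ m) f)"
  unfolding smooth_def by (metis comp_apply funpow_add)

lemma smooth_deriv: "smooth f \<Longrightarrow> smooth (deriv f)"
  using smooth_higher_deriv[of f 1] by simp

lemma smooth_has_deriv: "smooth f \<Longrightarrow> (f has_real_derivative deriv f x) (at x within A)"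
  unfolding smooth_def
  by (metis DERIV_deriv_iff_real_differentiable eq_id_iff funpow_0 has_field_derivative_at_within)

lemma smooth_differentiable: "smooth f \<Longrightarrow> f differentiable at x"
  unfolding smooth_def by (metis funpow_0)

lemma smooth_continuous_on: "smooth f \<Longrightarrow> continuous_on A f"
  by (meson DERIV_continuous_on smooth_has_deriv)

lemma smooth_antiderivative:
  assumes "\<And>x. (f has_real_derivative g x) (at x)" and "smooth g"
  shows "smooth f"
proof (rule smooth_coinduct[of _ "insert f (Collect smooth)"])
  have "deriv f = g" using assms(1) by (auto intro: DERIV_imp_deriv)
  then show "(\<forall>x. h differentiable at x) \<and> deriv h \<in> insert f (Collect smooth)"
    if "h \<in> insert f (Collect smooth)" for h
    using that assms smooth_deriv smooth_differentiable real_differentiable_def by auto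
qed auto

lemma deriv_add_smooth: "smooth f \<Longrightarrow> smooth g \<Longrightarrow> deriv (f + g) = deriv f + deriv g"
  unfolding plus_fun_def
  by (intro ext DERIV_imp_deriv DERIV_add smooth_has_deriv)

lemma deriv_scaleR_smooth: "smooth f \<Longrightarrow> deriv (c *\<^sub>R f) = c *\<^sub>R deriv f"
  unfolding scaleR_fun_def real_scaleR_def
  by (intro ext DERIV_imp_deriv DERIV_cmult smooth_has_deriv)

lemma smooth_add: assumes "smooth f" "smooth g" shows "smooth (f + g)"
proof (rule smooth_coinduct[of _ "{f + g |f g. smooth f \<and> smooth g}"])
  fix h assume "h \<in> {f + g |f g. smooth f \<and> smooth g}"
  then obtain f g where h: "h = f + g" "smooth f" "smooth g" by auto
  then have "h differentiable at x" for x
    by (simp add: plus_fun_def smooth_differentiable)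
  then show "(\<forall>x. h differentiable at x) \<and> deriv h \<in> {f + g |f g. smooth f \<and> smooth g}"
    using h deriv_add_smooth smooth_deriv by blast
qed (use assms in auto)

lemma smooth_scaleR: assumes "smooth f" shows "smooth (c *\<^sub>R f)"
proof (rule smooth_coinduct[of _ "{c *\<^sub>R f |f. smooth f}"])
  fix h assume "h \<in> {c *\<^sub>R f |f. smooth f}"
  then obtain f where h: "h = c *\<^sub>R f" "smooth f" by auto
  then have "h differentiable at x" for x
    by (simp add: scaleR_fun_def smooth_differentiable)
  then show "(\<forall>x. h differentiable at x) \<and> deriv h \<in> {c *\<^sub>R f |f. smooth f}"
    using h deriv_scaleR_smooth smooth_deriv by blast
qed (use assms in auto)

text \<open>The sums of products of smooth functions: by the product rule this class is closed under
  derivatives, which products alone are not.\<close>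

inductive_set smooth_products :: "(real \<Rightarrow> real) set" where
  times: "smooth f \<Longrightarrow> smooth g \<Longrightarrow> (\<lambda>x. f x * g x) \<in> smooth_products"
| plus: "f \<in> smooth_products \<Longrightarrow> g \<in> smooth_products \<Longrightarrow> (\<lambda>x. f x + g x) \<in> smooth_products"

lemma smooth_mult: assumes "smooth f" "smooth g" shows "smooth (\<lambda>x. f x * g x)"
proof (rule smooth_coinduct[of _ smooth_products])
  fix h assume "h \<in> smooth_products"
  then have "\<exists>k\<in>smooth_products. \<forall>x. (h has_real_derivative k x) (at x)"
  proof induction
    case (times f g)
    then show ?case
      by (intro bexI[of _ "\<lambda>x. f x * deriv g x + deriv f x * g x"] allI DERIV_mult'
          smooth_has_deriv smooth_products.intros smooth_deriv)
  next
    case (plus f g)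
    then obtain k l where "k \<in> smooth_products" "\<forall>x. (f has_real_derivative k x) (at x)"
      "l \<in> smooth_products" "\<forall>x. (g has_real_derivative l x) (at x)" by auto
    then show ?case
      by (intro bexI[of _ "\<lambda>x. k x + l x"] allI DERIV_add smooth_products.intros) auto
  qed
  then obtain k where k: "k \<in> smooth_products" "\<forall>x. (h has_real_derivative k x) (at x)" by blast
  then have "deriv h = k" by (auto intro: DERIV_imp_deriv)
  with k show "(\<forall>x. h differentiable at x) \<and> deriv h \<in> smooth_products"
    by (auto simp: real_differentiable_def)
qed (use assms in \<open>auto intro: smooth_products.intros\<close>)

text \<open>The functions \<open>p (1 / x) * exp (- 1 / x)\<close>, extended by \<open>0\<close> to \<open>x \<le> 0\<close>. The classical flat function
  is the case \<open>p = 1\<close>; admitting polynomials \<open>p\<close> gives a class closed under derivatives.\<close>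

definition flat :: "real poly \<Rightarrow> real \<Rightarrow> real"
  where "flat p x = (if x > 0 then poly p (1 / x) * exp (- (1 / x)) else 0)"

lemma flat_tendsto_0:
  fixes p :: "real poly"
  shows "((\<lambda>x. poly p (1 / x) * exp (- (1 / x))) \<longlongrightarrow> 0) (at_right 0)"
proof -
  have "poly p y * exp (- y) = (\<Sum>i\<le>degree p. coeff p i * (y ^ i / exp y))" for y
    unfolding poly_altdef sum_distrib_right exp_minus divide_inverse mult.assoc ..
  moreover have "((\<lambda>y. \<Sum>i\<le>degree p. coeff p i * (y ^ i / exp y)) \<longlongrightarrow>
      (\<Sum>i\<le>degree p. coeff p i * 0)) at_top"
    by (intro tendsto_sum tendsto_mult tendsto_const tendsto_power_div_exp_0)
  ultimately have "((\<lambda>y. poly p y * exp (- y)) \<longlongrightarrow> 0) at_top"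
    by simp
  from filterlim_compose[OF this filterlim_inverse_at_top_right]
  show ?thesis unfolding inverse_eq_divide .
qed

text \<open>Differentiating \<open>p y * exp (- y)\<close> with \<open>y = 1 / x\<close> yields \<open>y\<^sup>2 * (p y - p' y) * exp (- y)\<close>. At the
  origin the difference quotient is again of this kind, with \<open>y * p y\<close> in place of \<open>p y\<close>, and
  tends to \<open>0\<close>.\<close>

lemma flat_has_derivative:
  "(flat p has_real_derivative flat (pCons 0 (pCons 0 (p - pderiv p))) x) (at x)"
proof -
  consider "x < 0" | "x = 0" | "x > 0" by linarith
  then show ?thesis
  proof cases
    case 1
    have "((\<lambda>_. 0) has_real_derivative 0) (at x)" by simp
    then have "(flat p has_real_derivative 0) (at x)"
      by (rule has_field_derivative_transform_within_open[of _ _ _ "{..<0}"]) (use 1 in \<open>auto simp: flat_def\<close>)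
    then show ?thesis using 1 by (simp add: flat_def)
  next
    case 2
    have "((\<lambda>h. flat p h / h) \<longlongrightarrow> 0) (at_right 0)"
      using flat_tendsto_0[of "pCons 0 p"]
      by (rule Lim_transform_eventually)
        (auto simp: flat_def eventually_at_right_field intro!: exI[of _ 1])
    moreover have "((\<lambda>h. flat p h / h) \<longlongrightarrow> 0) (at_left 0)"
      by (rule tendsto_eventually) (auto simp: flat_def eventually_at_left_field intro!: exI[of _ "-1"])
    ultimately have "((\<lambda>h. flat p h / h) \<longlongrightarrow> 0) (at 0)"
      by (simp add: filterlim_at_split)
    then show ?thesis using 2 by (simp add: DERIV_def flat_def)
  next
    case 3
    have "((\<lambda>x. poly p (1 / x) * exp (- (1 / x))) has_real_derivative
        flat (pCons 0 (pCons 0 (p - pderiv p))) x) (at x)"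
      using 3 by (auto intro!: derivative_eq_intros DERIV_chain'[OF _ poly_DERIV] simp: flat_def)
        (simp add: field_simps power2_eq_square)
    then show ?thesis
      by (rule has_field_derivative_transform_within_open[of _ _ _ "{0<..}"]) (use 3 in \<open>auto simp: flat_def\<close>)
  qed
qed

lemma smooth_flat_affine: "smooth (\<lambda>x. flat p (\<alpha> * x + \<beta>))"
proof (rule smooth_coinduct[of _ "range (\<lambda>p x. flat p (\<alpha> * x + \<beta>))"])
  fix h assume "h \<in> range (\<lambda>p x. flat p (\<alpha> * x + \<beta>))"
  then obtain p where h: "h = (\<lambda>x. flat p (\<alpha> * x + \<beta>))" by blast
  define q where "q = smult \<alpha> (pCons 0 (pCons 0 (p - pderiv p)))"
  have "((\<lambda>x. \<alpha> * x + \<beta>) has_real_derivative \<alpha>) (at x)" for x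
    by (auto intro!: derivative_eq_intros)
  from DERIV_chain'[OF this flat_has_derivative]
  have d: "(h has_real_derivative flat q (\<alpha> * x + \<beta>)) (at x)" for x
    unfolding h q_def by (rule DERIV_cong) (simp add: flat_def)
  then have "deriv h = (\<lambda>x. flat q (\<alpha> * x + \<beta>))" by (auto intro: DERIV_imp_deriv)
  with d show "(\<forall>x. h differentiable at x) \<and> deriv h \<in> range (\<lambda>p x. flat p (\<alpha> * x + \<beta>))"
    by (auto simp: real_differentiable_def)
qed auto

text \<open>\<open>B\<close> is the normalised integral of the bump \<open>flat 1 (x - c) * flat 1 (d - x)\<close>.\<close>

lemma smooth_step_exists:
  fixes c d :: real
  assumes "c < d"
  obtains B \<rho> where "smooth B" "smooth \<rho>" "\<And>x. (B has_real_derivative \<rho> x) (at x)"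
    "\<And>x. 0 \<le> \<rho> x" "\<And>x. x \<notin> {c..d} \<Longrightarrow> \<rho> x = 0"
    "\<And>x. x \<le> c \<Longrightarrow> B x = 0" "\<And>x. d \<le> x \<Longrightarrow> B x = 1"
proof -
  define b where "b x = flat 1 (x - c) * flat 1 (d - x)" for x
  have b_smooth: "smooth b"
    using smooth_mult[OF smooth_flat_affine[of 1 1 "-c"] smooth_flat_affine[of 1 "-1" d]]
    unfolding b_def by simp
  have b_nonneg: "0 \<le> b x" and b_0: "x \<notin> {c<..<d} \<Longrightarrow> b x = 0" for x
    by (auto simp: b_def flat_def)
  define J where "J x = integral {c..x} b" for x
  have int: "b integrable_on {x..y}" for x y
    by (intro integrable_continuous_real smooth_continuous_on b_smooth)
  have J_left: "J x = 0" if "x \<le> c" for x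
    using that by (cases "x = c") (auto simp: J_def)
  \<comment> \<open>Starting the integral before \<open>c\<close> changes nothing and makes \<open>c\<close> an interior point, so that
    the two-sided derivative of \<open>J\<close> exists there as well.\<close>
  have J_shift: "J x = integral {c - 1..x} b" if "c - 1 \<le> x" for x
  proof (cases "c \<le> x")
    case True
    have "integral {c - 1..c} b = 0"
      by (intro integral_unique has_integral_is_0) (auto simp: b_0)
    then show ?thesis
      using True Henstock_Kurzweil_Integration.integral_combine[OF _ _ int, of "c - 1" c x]
      by (simp add: J_def)
  next
    case False
    have "integral {c - 1..x} b = 0"
      using False by (intro integral_unique has_integral_is_0) (auto simp: b_0)
    then show ?thesis using False by (simp add: J_left)
  qed
  have J_deriv: "(J has_real_derivative b x) (at x)" for x
  proof (cases "x < c")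
    case True
    have "((\<lambda>_. 0) has_real_derivative 0) (at x)" by simp
    then have "(J has_real_derivative 0) (at x)"
      by (rule has_field_derivative_transform_within_open[of _ _ _ "{..<c}"]) (use True in \<open>auto simp: J_left\<close>)
    then show ?thesis using True by (simp add: b_0)
  next
    case False
    have "((\<lambda>x. integral {c - 1..x} b) has_real_derivative b x) (at x within {c - 1..x + 1})"
      using False by (intro integral_has_real_derivative smooth_continuous_on b_smooth) auto
    then have "((\<lambda>x. integral {c - 1..x} b) has_real_derivative b x) (at x within {c - 1<..<x + 1})"
      by (rule DERIV_subset) auto
    then have "((\<lambda>x. integral {c - 1..x} b) has_real_derivative b x) (at x)"
      using False by (subst (asm) at_within_open) auto
    then show ?thesis
      by (rule has_field_derivative_transform_within_open[of _ _ _ "{c - 1<..}"])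
        (use False in \<open>auto simp: J_shift\<close>)
  qed
  have J_right: "J x = J d" if "d \<le> x" for x
  proof -
    have "integral {d..x} b = 0"
      by (intro integral_unique has_integral_is_0) (auto simp: b_0)
    then show ?thesis
      using that assms Henstock_Kurzweil_Integration.integral_combine[OF _ _ int, of c d x]
      by (simp add: J_def)
  qed
  have "J d \<noteq> 0"
  proof
    assume "J d = 0"
    then have "b ((c + d) / 2) = 0"
      using integral_eq_0_iff[of c d b] assms b_nonneg smooth_continuous_on[OF b_smooth]
      by (auto simp: J_def)
    then show False using assms by (auto simp: b_def flat_def)
  qed
  moreover have "0 \<le> J d"
    unfolding J_def by (intro integral_nonneg int b_nonneg)
  ultimately have J: "J d > 0" by simp
  show thesis
  proof (rule that[of "\<lambda>x. J x / J d" "\<lambda>x. b x / J d"])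
    show "smooth (\<lambda>x. b x / J d)"
      using smooth_scaleR[OF b_smooth, of "1 / J d"] by (simp add: scaleR_fun_def)
    show deriv: "((\<lambda>x. J x / J d) has_real_derivative b x / J d) (at x)" for x
      by (intro DERIV_cdivide J_deriv)
    from smooth_antiderivative[OF this \<open>smooth (\<lambda>x. b x / J d)\<close>]
    show "smooth (\<lambda>x. J x / J d)" .
    show "J x / J d = 1" if "d \<le> x" for x
      using J_right[OF that] J by simp
  qed (use J b_nonneg b_0 J_left in auto)
qed



section \<open>Test functions\<close>

text \<open>The support may be replaced by any compact set off which the function vanishes; sums and
  derivatives preserve such a set more visibly than the support.\<close>

lemma test_functions_iff:
  "\<phi> \<in> test_functions I \<longleftrightarrow>
    smooth \<phi> \<and> (\<exists>K. compact K \<and> K \<subseteq> I \<and> (\<forall>x. x \<notin> K \<longrightarrow> \<phi> x = 0))"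
proof -
  have "compact (supp \<phi>) \<and> supp \<phi> \<subseteq> K"
    if "compact K" "\<forall>x. x \<notin> K \<longrightarrow> \<phi> x = 0" for K
  proof -
    have "supp \<phi> \<subseteq> K"
      using that by (intro closure_minimal compact_imp_closed) (auto simp: support_on_def)
    moreover from this have "compact (supp \<phi>)"
      using that(1) by (meson closed_closure compact_eq_bounded_closed bounded_subset)
    ultimately show ?thesis by blast
  qed
  moreover have "\<phi> x = 0" if "x \<notin> supp \<phi>" for x
    using that closure_subset[of "support_on UNIV \<phi>"] by (auto simp: support_on_def)
  ultimately show ?thesis
    unfolding test_functions_def smooth_def mem_Collect_eq by (meson subset_trans)
qed

lemma deriv_eq_0_off_closed:
  assumes "closed K" "\<And>x. x \<notin> K \<Longrightarrow> \<phi> x = (0::real)" "x \<notin> K"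
  shows "(deriv ^^ m) \<phi> x = 0"
  using assms(3)
proof (induction m arbitrary: x)
  case (Suc m)
  have "((\<lambda>_. 0) has_real_derivative 0) (at x)" by simp
  then have "((deriv ^^ m) \<phi> has_real_derivative 0) (at x)"
    by (rule has_field_derivative_transform_within_open[of _ _ _ "- K"])
      (use assms(1) Suc in auto)
  then show ?case by (simp add: DERIV_imp_deriv)
qed (use assms in simp)

lemma deriv_test_function:
  assumes "\<phi> \<in> test_functions I"
  shows "deriv \<phi> \<in> test_functions I"
proof -
  obtain K where "smooth \<phi>" "compact K" "K \<subseteq> I" "\<And>x. x \<notin> K \<Longrightarrow> \<phi> x = 0"
    using assms unfolding test_functions_iff by blast
  then show ?thesis
    unfolding test_functions_iff
    using deriv_eq_0_off_closed[of K \<phi> _ 1] compact_imp_closed[of K]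
    by (intro conjI smooth_deriv exI[of _ K]) auto
qed

lemma add_test_function:
  assumes "\<phi> \<in> test_functions I" "\<psi> \<in> test_functions I"
  shows "\<phi> + \<psi> \<in> test_functions I"
proof -
  obtain K L where "compact K" "K \<subseteq> I" "\<And>x. x \<notin> K \<Longrightarrow> \<phi> x = 0"
    "compact L" "L \<subseteq> I" "\<And>x. x \<notin> L \<Longrightarrow> \<psi> x = 0"
    using assms unfolding test_functions_iff by blast
  then show ?thesis
    using assms unfolding test_functions_iff
    by (intro conjI smooth_add exI[of _ "K \<union> L"]) auto
qed

lemma scaleR_test_function:
  assumes "\<phi> \<in> test_functions I"
  shows "c *\<^sub>R \<phi> \<in> test_functions I"
  using assms smooth_scaleR unfolding test_functions_iff by (metis scaleR_fun_apply scaleR_zero_right)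

lemma interval_subset:
  fixes I :: "real set"
  assumes "is_interval I" "a \<in> I" "b \<in> I"
  shows "{a..b} \<subseteq> I"
  using assms unfolding is_interval_1 by (meson atLeastAtMost_iff subset_iff)

lemma compact_subset_interval:
  fixes I :: "real set"
  assumes "is_interval I" "I \<noteq> {}" "compact K" "K \<subseteq> I"
  obtains a b where "a \<le> b" "K \<subseteq> {a..b}" "{a..b} \<subseteq> I"
proof (cases "K = {}")
  case True
  obtain a where "a \<in> I" using assms(2) by blast
  then show thesis using that[of a a] True by auto
next
  case False
  obtain a b where ab: "a \<in> K" "b \<in> K" "\<And>x. x \<in> K \<Longrightarrow> a \<le> x \<and> x \<le> b"
    using compact_attains_inf[OF assms(3) False] compact_attains_sup[OF assms(3) False] by metis
  then have "{a..b} \<subseteq> I"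
    using assms(1,4) by (intro interval_subset) auto
  then show thesis using that[of a b] ab by fastforce
qed

text \<open>Off \<open>[a, b]\<close> the integrand vanishes, so the formula on \<open>[a, b]\<close> is also the integral over \<open>I\<close>.\<close>

lemma has_integral_mult_smooth:
  fixes G \<psi> :: "real \<Rightarrow> real"
  assumes G: "G integrable_on I"
    and ab: "a \<le> b" "{a..b} \<subseteq> I"
    and \<psi>: "smooth \<psi>" "\<And>x. x \<notin> {a..b} \<Longrightarrow> \<psi> x = 0"
  shows "((\<lambda>t. G t * \<psi> t) has_integral integral {a..b} G * \<psi> b
      - integral {a..b} (\<lambda>x. integral {a..x} G * deriv \<psi> x)) I"
proof (rule has_integral_on_superset)
  have "G integrable_on {a..b}"
    by (metis G ab(2) integrable_on_subinterval)
  then show "((\<lambda>t. G t * \<psi> t) has_integral integral {a..b} G * \<psi> b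
      - integral {a..b} (\<lambda>x. integral {a..x} G * deriv \<psi> x)) {a..b}"
    by (intro has_integral_mult_C1 ab smooth_has_deriv smooth_continuous_on smooth_deriv \<psi>)
qed (use ab \<psi> in auto)

lemma integrable_test_mult:
  assumes I: "is_interval I" "I \<noteq> {}" and G: "G integrable_on I"
    and \<phi>: "\<phi> \<in> test_functions I"
  shows "(\<lambda>t. G t * \<phi> t) integrable_on I"
proof -
  obtain K where K: "smooth \<phi>" "compact K" "K \<subseteq> I" "\<And>x. x \<notin> K \<Longrightarrow> \<phi> x = 0"
    using \<phi> unfolding test_functions_iff by blast
  obtain a b where "a \<le> b" "K \<subseteq> {a..b}" "{a..b} \<subseteq> I"
    using compact_subset_interval[OF I K(2,3)] .
  with K show ?thesis
    using has_integral_mult_smooth[OF G, of a b \<phi>] by (meson has_integral_integrable subset_iff)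
qed

section \<open>Left continuous functions determined by their integrals\<close>

text \<open>The limit at \<open>inf I\<close> is thus decided by the values at points of left continuity.\<close>

lemma inf_right_eventually:
  fixes I :: "real set"
  assumes "is_interval I" "\<exists>a\<in>I. \<exists>b\<in>I. a < b"
  shows "eventually (\<lambda>t. t \<in> I \<and> \<not> is_min I t) (inf_right I)"
proof -
  obtain a b where ab: "a \<in> I" "b \<in> I" "a < b" using assms(2) by blast
  have *: "t \<in> I \<and> \<not> is_min I t" if "u \<in> I" "u < t" "t < b" for u t
    using interval_subset[OF assms(1) that(1) ab(2)] that by (force simp: is_min_def not_le)
  show ?thesis
  proof (cases "bdd_below I")
    case True
    have "Inf I < b" using cInf_lower[OF ab(1) True] ab(3) by simp
    moreover have "t \<in> I \<and> \<not> is_min I t" if t: "Inf I < t" "t < b" for t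
      using t(1) cInf_less_iff[of I t] True ab(1) * t(2) by blast
    ultimately show ?thesis
      using True by (auto simp: inf_right_def eventually_at_right_field)
  next
    case False
    have "t \<in> I \<and> \<not> is_min I t" if "t < b" for t
      using False * that unfolding bdd_below_def by (meson not_le)
    then have "eventually (\<lambda>t. t \<in> I \<and> \<not> is_min I t) at_bot"
      unfolding eventually_at_bot_dense by blast
    then show ?thesis
      using False by (simp add: inf_right_def)
  qed
qed

lemma inf_right_neq_bot: "inf_right I \<noteq> bot"
  by (simp add: inf_right_def)

text \<open>A left limit that equals the value is in particular a finite left limit, hence left regularity.\<close>

lemma Dlc_iff:
  "G \<in> Dlc I \<longleftrightarrow> (\<forall>t. t \<notin> I \<longrightarrow> G t = 0) \<and> G integrable_on I \<and>
    (\<exists>l. (G \<longlongrightarrow> l) (inf_right I)) \<and>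
    (\<forall>t\<in>I. \<not> is_min I t \<longrightarrow> (G \<longlongrightarrow> G t) (at_left t)) \<and>
    (\<forall>m. is_min I m \<longrightarrow> (G \<longlongrightarrow> G m) (at_right m))"
  unfolding Dlc_def functions_on_def left_regulated_def continuous_within by auto

lemma Dlc_tendsto_left:
  assumes "G \<in> Dlc I" "t \<in> I" "\<not> is_min I t"
  shows "(G \<longlongrightarrow> G t) (at_left t)"
  using assms by (simp add: Dlc_iff)

lemma not_is_minE:
  fixes I :: "real set"
  assumes "is_interval I" "t \<in> I" "\<not> is_min I t"
  obtains u where "u < t" "{u..t} \<subseteq> I"
  using assms interval_subset[OF assms(1) _ assms(2)] unfolding is_min_def by (meson not_le)

lemma Dlc_close_left:
  assumes "is_interval I" "G \<in> Dlc I" "t \<in> I" "\<not> is_min I t" "0 < e"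
  obtains u where "u < t" "{u..t} \<subseteq> I" "\<And>x. x \<in> {u..t} \<Longrightarrow> \<bar>G x - G t\<bar> < e"
proof -
  obtain u0 where u0: "u0 < t" "{u0..t} \<subseteq> I" using assms not_is_minE by blast
  from Dlc_tendsto_left[OF assms(2-4)] obtain u1 where u1: "u1 < t"
    "\<And>x. u1 < x \<Longrightarrow> x < t \<Longrightarrow> \<bar>G x - G t\<bar> < e"
    using assms(5) unfolding tendsto_iff eventually_at_left_field dist_real_def by metis
  define u where "u = max u0 ((u1 + t) / 2)"
  have "u < t" "{u..t} \<subseteq> {u0..t}" "u1 < u" using u0 u1 by (auto simp: u_def max_def field_simps)
  moreover from this have "\<bar>G x - G t\<bar> < e" if "x \<in> {u..t}" for x
    using u1(2)[of x] that assms(5) by (cases "x = t") auto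
  ultimately show thesis using that u0 by (meson subset_trans)
qed

text \<open>The value at the minimum is the right limit there, a limit of values at other points of \<open>I\<close>.\<close>

lemma Dlc_nonneg_of_non_min:
  assumes I: "is_interval I" "\<exists>a\<in>I. \<exists>b\<in>I. a < b" and G: "G \<in> Dlc I"
    and nonneg: "\<And>t. t \<in> I \<Longrightarrow> \<not> is_min I t \<Longrightarrow> 0 \<le> G t" and "t \<in> I"
  shows "0 \<le> G t"
proof (cases "is_min I t")
  case True
  obtain b where b: "b \<in> I" "t < b"
    using I(2) True unfolding is_min_def by (meson le_less_trans)
  have "0 \<le> G x" if "t < x" "x < b" for x
    using interval_subset[OF I(1) \<open>t \<in> I\<close> b(1)] that \<open>t \<in> I\<close> by (intro nonneg) (force simp: is_min_def not_le)+
  then have "eventually (\<lambda>x. 0 \<le> G x) (at_right t)"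
    using b(2) unfolding eventually_at_right_field by blast
  moreover have "(G \<longlongrightarrow> G t) (at_right t)"
    using G True by (auto simp: Dlc_def)
  ultimately show ?thesis by (intro tendsto_lowerbound) auto
qed (use assms in auto)

text \<open>If \<open>G t < 0\<close>, left continuity gives an interval \<open>[u, t]\<close> on which \<open>G \<le> G t / 2\<close>, and the integral
  over it is negative.\<close>

lemma Dlc_nonneg_of_integrals:
  assumes I: "is_interval I" "\<exists>a\<in>I. \<exists>b\<in>I. a < b" and G: "G \<in> Dlc I"
    and int: "\<And>a b. a \<le> b \<Longrightarrow> {a..b} \<subseteq> I \<Longrightarrow> 0 \<le> integral {a..b} G" and "t \<in> I"
  shows "0 \<le> G t"
proof (rule Dlc_nonneg_of_non_min[OF I G _ \<open>t \<in> I\<close>])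
  fix t assume t: "t \<in> I" "\<not> is_min I t"
  show "0 \<le> G t"
  proof (rule ccontr)
    assume "\<not> 0 \<le> G t"
    then obtain u where u: "u < t" "{u..t} \<subseteq> I" "\<And>x. x \<in> {u..t} \<Longrightarrow> \<bar>G x - G t\<bar> < - G t / 2"
      using Dlc_close_left[OF I(1) G t, of "- G t / 2"] by auto
    have "G integrable_on {u..t}"
      using G u(2) integrable_on_subinterval by (auto simp: Dlc_def)
    moreover have "G x \<le> G t / 2" if "x \<in> {u..t}" for x
      using u(3)[OF that] by linarith
    ultimately have "integral {u..t} G \<le> integral {u..t} (\<lambda>x. G t / 2)"
      by (intro integral_le) auto
    also have "\<dots> < 0" using u(1) \<open>\<not> 0 \<le> G t\<close> by (simp add: mult_less_0_iff)
    finally show False using int[of u t] u by simp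
  qed
qed

lemma subspace_Dlc: "subspace (Dlc I)"
  unfolding subspace_def
proof (intro conjI allI ballI)
  show "0 \<in> Dlc I"
    by (auto simp: Dlc_iff zero_fun_def integrable_0)
next
  fix F G assume FG: "F \<in> Dlc I" "G \<in> Dlc I"
  then obtain k l where "(F \<longlongrightarrow> k) (inf_right I)" "(G \<longlongrightarrow> l) (inf_right I)"
    unfolding Dlc_iff by blast
  then have "\<exists>l. ((\<lambda>t. F t + G t) \<longlongrightarrow> l) (inf_right I)"
    using tendsto_add by blast
  with FG show "F + G \<in> Dlc I"
    unfolding Dlc_iff plus_fun_def by (simp add: integrable_add tendsto_add)
next
  fix c F assume F: "F \<in> Dlc I"
  then obtain l where "(F \<longlongrightarrow> l) (inf_right I)"
    unfolding Dlc_iff by blast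
  then have "\<exists>l. ((\<lambda>t. c *\<^sub>R F t) \<longlongrightarrow> l) (inf_right I)"
    using tendsto_scaleR[OF tendsto_const] by blast
  with F show "c *\<^sub>R F \<in> Dlc I"
    unfolding Dlc_iff scaleR_fun_def using integrable_cmul[of F I c] by (simp add: tendsto_mult_left)
qed

lemma Dlc0_subset_Dlc: "Dlc0 I \<subseteq> Dlc I"
  by (auto simp: Dlc0_def)

lemma Dlc_integrable: "G \<in> Dlc I \<Longrightarrow> G integrable_on I"
  by (simp add: Dlc_def)

lemma subspace_Dlc0: "subspace (Dlc0 I)"
  using subspace_Dlc[of I] unfolding subspace_def Dlc0_def plus_fun_def scaleR_fun_def zero_fun_def
  by (auto intro: tendsto_add_zero tendsto_mult_right_zero)


section \<open>The Alexiewicz norm and the pointwise order\<close>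

lemma (in normed_space_on) closedin_nrm_topology_iff:
  "closedin nrm_topology C \<longleftrightarrow> C \<subseteq> E \<and> (\<forall>x\<in>E - C. \<exists>r>0. \<forall>y\<in>C. r \<le> nrm (x - y))"
proof -
  interpret Metric_space E nrm_dist by (rule Metric_space_nrm_dist)
  have "disjnt C (mball x r) \<longleftrightarrow> (\<forall>y\<in>C. r \<le> nrm (x - y))" if "C \<subseteq> E" "x \<in> E" for x r
    using that by (fastforce simp: disjnt_def in_mball nrm_dist_def)
  then show ?thesis
    unfolding nrm_topology_def closedin_metric by (metis DiffD1)
qed

lemma alexiewicz_norm_upper:
  assumes "F integrable_on I" "a \<le> b" "{a..b} \<subseteq> I"
  shows "\<bar>integral {a..b} F\<bar> \<le> alexiewicz_norm I F"
  unfolding alexiewicz_norm_def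
  using cSUP_upper[OF _ bdd_above_alexiewicz[OF assms(1)], of "(a, b)"] assms by auto

lemma alexiewicz_norm_least:
  assumes "I \<noteq> {}" "\<And>a b. a \<le> b \<Longrightarrow> {a..b} \<subseteq> I \<Longrightarrow> \<bar>integral {a..b} F\<bar> \<le> c"
  shows "alexiewicz_norm I F \<le> c"
proof -
  obtain a where "a \<in> I" using assms(1) by blast
  then have "{(a, b). a \<le> b \<and> {a..b} \<subseteq> I} \<noteq> {}"
    by (auto intro!: exI[of _ a])
  then show ?thesis
    unfolding alexiewicz_norm_def by (rule cSUP_least) (use assms(2) in auto)
qed

lemma alexiewicz_norm_nonneg:
  assumes "F integrable_on I" "I \<noteq> {}"
  shows "0 \<le> alexiewicz_norm I F"
proof -
  obtain a where "a \<in> I" using assms(2) by blast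
  then show ?thesis using alexiewicz_norm_upper[OF assms(1), of a a] by auto
qed

text \<open>If the norm is \<open>0\<close>, all integrals vanish, so both \<open>G\<close> and \<open>-G\<close> are nonnegative.\<close>

lemma alexiewicz_norm_eq_0_iff:
  assumes I: "is_interval I" "\<exists>a\<in>I. \<exists>b\<in>I. a < b" and G: "G \<in> Dlc I"
  shows "alexiewicz_norm I G = 0 \<longleftrightarrow> G = 0"
proof
  assume "alexiewicz_norm I G = 0"
  then have 0: "integral {a..b} G = 0" if "a \<le> b" "{a..b} \<subseteq> I" for a b
    using alexiewicz_norm_upper[OF Dlc_integrable[OF G] that] by simp
  have "- G \<in> Dlc I"
    using subspace_neg[OF subspace_Dlc G] .
  moreover have "0 \<le> integral {a..b} (- G)" if "a \<le> b" "{a..b} \<subseteq> I" for a b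
    using 0[OF that] by (simp add: fun_Compl_def)
  ultimately have "0 \<le> (- G) t" if "t \<in> I" for t
    using Dlc_nonneg_of_integrals[OF I] that by blast
  moreover have "0 \<le> G t" if "t \<in> I" for t
    using 0 that by (intro Dlc_nonneg_of_integrals[OF I G]) auto
  ultimately have "G t = 0" if "t \<in> I" for t
    using that by (force intro: antisym)
  then show "G = 0"
    using G by (auto simp: Dlc_def functions_on_def fun_eq_iff)
next
  assume "G = 0"
  moreover have "alexiewicz_norm I 0 \<le> 0"
    by (rule alexiewicz_norm_least) (use I in \<open>auto simp: zero_fun_def\<close>)
  moreover have "0 \<le> alexiewicz_norm I G"
    using I by (intro alexiewicz_norm_nonneg Dlc_integrable G) auto
  ultimately show "alexiewicz_norm I G = 0" by simp
qed

text \<open>Closedness of the cone: when \<open>F\<close> in \<open>E\<close> is not nonnegative, some integral over \<open>[a, b]\<close> of \<open>F\<close>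
  is negative, while that of any \<open>G\<close> in the cone is not. The two integrals differ by at most the
  norm of \<open>F - G\<close>, so \<open>F\<close> has positive distance from the cone.\<close>

lemma ordered_normed_space_on_subspace_Dlc:
  assumes I: "is_interval I" "\<exists>a\<in>I. \<exists>b\<in>I. a < b"
    and E: "subspace E" "E \<subseteq> Dlc I"
  shows "ordered_normed_space_on E (pointwise_le I) (alexiewicz_norm I)"
proof -
  have ne: "I \<noteq> {}" using I(2) by blast
  have intI: "F integrable_on I" if "F \<in> E" for F using that E(2) Dlc_integrable by blast
  have int: "F integrable_on {a..b}" if "F \<in> E" "{a..b} \<subseteq> I" for F a b
    using integrable_on_subinterval[OF intI] that by blast
  have upper: "\<bar>integral {a..b} F\<bar> \<le> alexiewicz_norm I F"
    if "F \<in> E" "a \<le> b" "{a..b} \<subseteq> I" for F a b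
    using alexiewicz_norm_upper[OF intI] that by blast
  interpret ordered_vector_space_on E "pointwise_le I"
  proof
    show "antisymp_on E (pointwise_le I)"
    proof (rule antisymp_onI)
      fix F G assume *: "F \<in> E" "G \<in> E" "pointwise_le I F G" "pointwise_le I G F"
      have "F t = G t" for t
      proof (cases "t \<in> I")
        case False
        then show ?thesis using subsetD[OF E(2) *(1)] subsetD[OF E(2) *(2)] by (simp add: Dlc_iff)
      qed (use * in \<open>auto simp: pointwise_le_def intro: antisym\<close>)
      then show "F = G" by blast
    qed
  qed (auto simp: E pointwise_le_def reflp_on_def transp_on_def mult_left_mono intro: order_trans)
  interpret normed_space_on E "alexiewicz_norm I"
  proof
    fix F G assume F: "F \<in> E"
    show "0 \<le> alexiewicz_norm I F" by (intro alexiewicz_norm_nonneg intI F ne)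
    show "alexiewicz_norm I F = 0 \<longleftrightarrow> F = 0"
      using alexiewicz_norm_eq_0_iff[OF I] F E(2) by blast
    show "alexiewicz_norm I (F + G) \<le> alexiewicz_norm I F + alexiewicz_norm I G" if G: "G \<in> E"
    proof (rule alexiewicz_norm_least[OF ne])
      fix a b assume ab: "a \<le> b" "{a..b} \<subseteq> I"
      have "integral {a..b} (F + G) = integral {a..b} F + integral {a..b} G"
        unfolding plus_fun_def by (intro integral_add int F G ab)
      then show "\<bar>integral {a..b} (F + G)\<bar> \<le> alexiewicz_norm I F + alexiewicz_norm I G"
        using upper[OF F ab] upper[OF G ab] by linarith
    qed
    \<comment> \<open>This inequality for \<open>k\<close> and for \<open>1 / k\<close> gives the equation.\<close>
    have scale_le: "alexiewicz_norm I (k *\<^sub>R F) \<le> \<bar>k\<bar> * alexiewicz_norm I F" if F: "F \<in> E" for k F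
    proof (rule alexiewicz_norm_least[OF ne])
      fix a b assume ab: "a \<le> b" "{a..b} \<subseteq> I"
      show "\<bar>integral {a..b} (k *\<^sub>R F)\<bar> \<le> \<bar>k\<bar> * alexiewicz_norm I F"
        unfolding scaleR_fun_def integral_cmul
        using upper[OF F ab] by (simp add: abs_mult mult_left_mono)
    qed
    show "alexiewicz_norm I (k *\<^sub>R F) = \<bar>k\<bar> * alexiewicz_norm I F" for k
    proof (cases "k = 0")
      case True
      have "alexiewicz_norm I 0 = 0"
        using alexiewicz_norm_eq_0_iff[OF I] subspace_0[OF E(1)] E(2) by blast
      then show ?thesis using True by simp
    next
      case False
      then have "alexiewicz_norm I F \<le> \<bar>1 / k\<bar> * alexiewicz_norm I (k *\<^sub>R F)"
        using scale_le[OF subspace_scale[OF E(1) F], of "1 / k" k] by simp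
      then show ?thesis using False scale_le[OF F, of k] by (simp add: field_simps)
    qed
  qed (rule E)
  show ?thesis
  proof
    show "closedin nrm_topology cone"
      unfolding closedin_nrm_topology_iff
    proof (intro conjI ballI)
      fix F assume "F \<in> E - cone"
      then have F: "F \<in> E" "\<not> (\<forall>t\<in>I. 0 \<le> F t)"
        by (auto simp: cone_def pointwise_le_def)
      then obtain a b where ab: "a \<le> b" "{a..b} \<subseteq> I" "integral {a..b} F < 0"
        using Dlc_nonneg_of_integrals[OF I, of F] E(2) by (meson not_le subset_iff)
      have "- integral {a..b} F \<le> alexiewicz_norm I (F - G)" if "G \<in> cone" for G
      proof -
        have G: "G \<in> E" "\<And>t. t \<in> I \<Longrightarrow> 0 \<le> G t"
          using that by (auto simp: cone_def pointwise_le_def)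
        have "0 \<le> integral {a..b} G"
          using G ab by (intro integral_nonneg int) auto
        moreover have "integral {a..b} (F - G) = integral {a..b} F - integral {a..b} G"
          unfolding fun_diff_def by (intro integral_diff int F G ab)
        ultimately show ?thesis
          using upper[OF subspace_diff[OF E(1) F(1) G(1)] ab(1,2)] by linarith
      qed
      then show "\<exists>r>0. \<forall>G\<in>cone. r \<le> alexiewicz_norm I (F - G)"
        using ab(3) by (intro exI[of _ "- integral {a..b} F"]) auto
    qed (auto simp: cone_def)
  qed
qed

text \<open>A linear bijection that transports order and norm also transports the distance and the cone.\<close>

lemma ordered_normed_space_on_linear_pullback:
  fixes h :: "'a::real_vector \<Rightarrow> 'b::real_vector"
  assumes E: "ordered_normed_space_on E le nrm" and V: "subspace V"
    and bij: "bij_betw h V E"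
    and add: "\<And>x y. x \<in> V \<Longrightarrow> y \<in> V \<Longrightarrow> h (x + y) = h x + h y"
    and scale: "\<And>c x. x \<in> V \<Longrightarrow> h (c *\<^sub>R x) = c *\<^sub>R h x"
  shows "ordered_normed_space_on V (\<lambda>x y. le (h x) (h y)) (\<lambda>x. nrm (h x))"
proof -
  interpret E: ordered_normed_space_on E le nrm by (rule E)
  have hE: "h x \<in> E" if "x \<in> V" for x using bij that by (auto simp: bij_betw_def)
  have h_eq: "h x = h y \<longleftrightarrow> x = y" if "x \<in> V" "y \<in> V" for x y
    using bij that by (auto simp: bij_betw_def inj_on_def)
  have h0: "h 0 = 0"
    using scale[OF subspace_0[OF V], of 0] by simp
  have diff: "h (x - y) = h x - h y" if "x \<in> V" "y \<in> V" for x y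
    using add[OF that(1) subspace_scale[OF V that(2), of "-1"]] scale[OF that(2), of "-1"] by simp
  interpret ordered_vector_space_on V "\<lambda>x y. le (h x) (h y)"
  proof
    show "reflp_on V (\<lambda>x y. le (h x) (h y))"
      using E.le_refl hE by (simp add: reflp_on_def)
    show "antisymp_on V (\<lambda>x y. le (h x) (h y))"
      by (intro antisymp_onI) (metis antisymp_onD[OF E.le_antisym] hE h_eq)
    show "transp_on V (\<lambda>x y. le (h x) (h y))"
      using E.le_trans hE unfolding transp_on_def by blast
  qed (simp_all add: V add scale hE E.le_add_right E.le_scaleR)
  interpret normed_space_on V "\<lambda>x. nrm (h x)"
    using h_eq[OF _ subspace_0[OF V]]
    by unfold_locales (auto simp: V add scale hE h0 E.nrm_nonneg E.nrm_eq_0_iff E.nrm_triangle E.nrm_scaleR)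
  have cone_iff: "x \<in> cone \<longleftrightarrow> h x \<in> E.cone" if "x \<in> V" for x
    using that hE by (simp add: cone_def E.cone_def h0)
  show ?thesis
  proof
    show "closedin nrm_topology cone"
      unfolding closedin_nrm_topology_iff
    proof (intro conjI ballI)
      fix x assume x: "x \<in> V - cone"
      then have "h x \<in> E - E.cone" using hE cone_iff by blast
      then obtain r where "r > 0" "\<forall>y\<in>E.cone. r \<le> nrm (h x - y)"
        using E.closedin_cone unfolding E.closedin_nrm_topology_iff by blast
      then show "\<exists>r>0. \<forall>y\<in>cone. r \<le> nrm (h (x - y))"
        using x cone_iff diff by (metis DiffD1 cone_def mem_Collect_eq)
    qed (auto simp: cone_def)
  qed
qed


section \<open>Distributional derivatives\<close>

text \<open>By parts, \<open>\<integral> G \<phi>' = P b * \<phi>' b - \<integral> P \<phi>''\<close> with the continuous primitive \<open>P\<close> of \<open>G\<close>, and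
  the first and second derivatives converge uniformly.\<close>

lemma test_mult_tendsto:
  assumes I: "is_interval I" "I \<noteq> {}" and G: "G integrable_on I"
    and \<Phi>: "\<And>n. \<Phi> n \<in> test_functions I" and \<phi>: "\<phi> \<in> test_functions I"
    and lim: "test_tendsto I \<Phi> \<phi>"
  shows "(\<lambda>n. integral I (\<lambda>t. G t * deriv (\<Phi> n) t)) \<longlonglongrightarrow> integral I (\<lambda>t. G t * deriv \<phi> t)"
proof -
  obtain K where K: "compact K" "K \<subseteq> I" "\<And>n. supp (\<Phi> n) \<subseteq> K" "supp \<phi> \<subseteq> K"
    and unif: "\<And>m. uniform_limit K (\<lambda>n. (deriv ^^ m) (\<Phi> n)) ((deriv ^^ m) \<phi>) sequentially"
    using lim unfolding test_tendsto_def by blast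
  have off: "f x = 0" if "supp f \<subseteq> K" "x \<notin> K" for f x
    using that closure_subset[of "support_on UNIV f"] by (auto simp: support_on_def)
  have \<Phi>0: "(deriv ^^ m) (\<Phi> n) x = 0" and \<phi>0: "(deriv ^^ m) \<phi> x = 0" if "x \<notin> K" for m n x
    by (rule deriv_eq_0_off_closed[OF compact_imp_closed[OF K(1)] off[OF K(3)[of n]] that];
        assumption)
      (rule deriv_eq_0_off_closed[OF compact_imp_closed[OF K(1)] off[OF K(4)] that]; assumption)
  \<comment> \<open>The interval \<open>[a, b]\<close> below may be larger than \<open>K\<close>, but all functions vanish off \<open>K\<close>.\<close>
  have unif_UNIV: "uniform_limit UNIV (\<lambda>n. (deriv ^^ m) (\<Phi> n)) ((deriv ^^ m) \<phi>) sequentially" for m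
  proof (rule uniform_limitI)
    fix e :: real assume "e > 0"
    from uniform_limitD[OF unif[of m] this]
    show "\<forall>\<^sub>F n in sequentially. \<forall>x\<in>UNIV. dist ((deriv ^^ m) (\<Phi> n) x) ((deriv ^^ m) \<phi> x) < e"
      by eventually_elim (use \<Phi>0 \<phi>0 \<open>e > 0\<close> in \<open>metis dist_self\<close>)
  qed
  have U1: "uniform_limit UNIV (\<lambda>n. deriv (\<Phi> n)) (deriv \<phi>) sequentially"
    using unif_UNIV[of 1] by simp
  have U2: "uniform_limit UNIV (\<lambda>n. deriv (deriv (\<Phi> n))) (deriv (deriv \<phi>)) sequentially"
    using unif_UNIV[of 2] by (simp add: eval_nat_numeral)
  obtain a b where ab: "a \<le> b" "K \<subseteq> {a..b}" "{a..b} \<subseteq> I"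
    using compact_subset_interval[OF I K(1,2)] .
  define P where "P x = integral {a..x} G" for x
  have P: "continuous_on {a..b} P"
    unfolding P_def by (intro indefinite_integral_continuous_1 integrable_on_subinterval[OF G ab(3)])
  have smooth: "smooth (\<Phi> n)" "smooth \<phi>" for n
    using \<Phi> \<phi> by (auto simp: test_functions_iff)
  have parts: "integral I (\<lambda>t. G t * deriv \<psi> t)
      = P b * deriv \<psi> b - integral {a..b} (\<lambda>x. P x * deriv (deriv \<psi>) x)"
    if "smooth \<psi>" "\<And>x. x \<notin> K \<Longrightarrow> deriv \<psi> x = 0" for \<psi>
  proof -
    have "deriv \<psi> x = 0" if "x \<notin> {a..b}" for x
      using \<open>\<And>x. x \<notin> K \<Longrightarrow> deriv \<psi> x = 0\<close> ab(2) that by blast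
    from has_integral_mult_smooth[OF G ab(1,3) smooth_deriv[OF \<open>smooth \<psi>\<close>] this]
    show ?thesis unfolding P_def by (rule integral_unique)
  qed
  have cont: "continuous_on {a..b} (deriv (deriv \<psi>))" if "smooth \<psi>" for \<psi>
    by (intro smooth_continuous_on smooth_deriv that)
  have "bounded (P ` {a..b})" "bounded (deriv (deriv \<phi>) ` {a..b})"
    by (intro compact_imp_bounded compact_continuous_image P cont smooth compact_Icc)+
  then have "uniform_limit {a..b} (\<lambda>n x. P x * deriv (deriv (\<Phi> n)) x)
      (\<lambda>x. P x * deriv (deriv \<phi>) x) sequentially"
    by (intro uniform_lim_mult uniform_limit_const uniform_limit_on_subset[OF U2] subset_UNIV)
  from uniform_limit_integral[OF this continuous_on_mult[OF P cont[OF smooth(1)]] sequentially_bot]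
  obtain J j where J: "\<And>n. ((\<lambda>x. P x * deriv (deriv (\<Phi> n)) x) has_integral J n) {a..b}"
    "((\<lambda>x. P x * deriv (deriv \<phi>) x) has_integral j) {a..b}" "J \<longlonglongrightarrow> j"
    by metis
  have "(\<lambda>n. deriv (\<Phi> n) b) \<longlonglongrightarrow> deriv \<phi> b"
    by (rule tendsto_uniform_limitI[OF U1 UNIV_I])
  then have "(\<lambda>n. P b * deriv (\<Phi> n) b - J n) \<longlonglongrightarrow> P b * deriv \<phi> b - j"
    by (intro tendsto_intros J)
  moreover have "integral I (\<lambda>t. G t * deriv (\<Phi> n) t) = P b * deriv (\<Phi> n) b - J n" for n
    using parts[OF smooth(1)] \<Phi>0[of _ 1] J(1) by (simp add: integral_unique)
  moreover have "integral I (\<lambda>t. G t * deriv \<phi> t) = P b * deriv \<phi> b - j"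
    using parts[OF smooth(2)] \<phi>0[of _ 1] J(2) by (simp add: integral_unique)
  ultimately show ?thesis by simp
qed

abbreviation deriv_of :: "real set \<Rightarrow> (real \<Rightarrow> real) \<Rightarrow> (real \<Rightarrow> real) \<Rightarrow> real"
  where "deriv_of I F \<equiv> distr_deriv I (distr_of I F)"

lemma deriv_of_apply:
  "deriv_of I F \<phi> = (if \<phi> \<in> test_functions I then - integral I (\<lambda>t. F t * deriv \<phi> t) else 0)"
  by (simp add: distr_deriv_def distr_of_def deriv_test_function)

lemma deriv_of_in_distributions:
  assumes I: "is_interval I" "I \<noteq> {}" and F: "F integrable_on I"
  shows "deriv_of I F \<in> distributions I"
  unfolding distributions_def mem_Collect_eq
proof (intro conjI allI ballI impI)
  note int = integrable_test_mult[OF I F deriv_test_function]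
  fix \<phi>
  show "deriv_of I F \<phi> = 0" if "\<phi> \<notin> test_functions I"
    using that by (simp add: deriv_of_apply)
  assume \<phi>: "\<phi> \<in> test_functions I"
  then have \<phi>s: "smooth \<phi>" by (simp add: test_functions_iff)
  show "deriv_of I F (c *\<^sub>R \<phi>) = c * deriv_of I F \<phi>" for c
    by (simp add: deriv_of_apply \<phi> scaleR_test_function deriv_scaleR_smooth[OF \<phi>s] mult.left_commute)
  show "deriv_of I F (\<phi> + \<psi>) = deriv_of I F \<phi> + deriv_of I F \<psi>" if \<psi>: "\<psi> \<in> test_functions I" for \<psi>
  proof -
    have \<psi>s: "smooth \<psi>" using \<psi> by (simp add: test_functions_iff)
    show ?thesis
      using integral_add[OF int[OF \<phi>] int[OF \<psi>]]
      by (simp add: deriv_of_apply \<phi> \<psi> add_test_function deriv_add_smooth[OF \<phi>s \<psi>s] distrib_left)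
  qed
  show "(\<lambda>n. deriv_of I F (\<Phi> n)) \<longlonglongrightarrow> deriv_of I F \<phi>"
    if "range \<Phi> \<subseteq> test_functions I" "test_tendsto I \<Phi> \<phi>" for \<Phi>
  proof -
    have \<Phi>: "\<Phi> n \<in> test_functions I" for n using that by blast
    show ?thesis
      using tendsto_minus[OF test_mult_tendsto[OF I F \<Phi> \<phi> that(2)]] by (simp add: deriv_of_apply \<phi> \<Phi>)
  qed
qed

lemma deriv_of_add:
  assumes I: "is_interval I" "I \<noteq> {}" and "F integrable_on I" "G integrable_on I"
  shows "deriv_of I (F + G) = deriv_of I F + deriv_of I G"
proof
  fix \<phi>
  show "deriv_of I (F + G) \<phi> = (deriv_of I F + deriv_of I G) \<phi>"
    using integral_add[OF integrable_test_mult[OF I assms(3)] integrable_test_mult[OF I assms(4)]]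
      deriv_test_function[of \<phi> I]
    by (simp add: deriv_of_apply distrib_right)
qed

lemma deriv_of_scaleR: "deriv_of I (c *\<^sub>R F) = c *\<^sub>R deriv_of I F"
  by (rule ext) (simp add: deriv_of_apply mult.assoc)


section \<open>Uniqueness of the primitive\<close>

text \<open>The integral of \<open>G * \<rho>\<close> is an average of the values of \<open>G\<close> on \<open>[c, d]\<close>.\<close>

lemma kernel_average_close:
  fixes G \<rho> :: "real \<Rightarrow> real"
  assumes G: "G integrable_on I"
    and cd: "c \<le> d" "{c..d} \<subseteq> I" and close: "\<And>x. x \<in> {c..d} \<Longrightarrow> \<bar>G x - L\<bar> \<le> e"
    and \<rho>: "smooth \<rho>" "\<And>x. 0 \<le> \<rho> x" "\<And>x. x \<notin> {c..d} \<Longrightarrow> \<rho> x = 0" "(\<rho> has_integral 1) {c..d}"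
  shows "(\<lambda>t. G t * \<rho> t) integrable_on I" and "\<bar>integral I (\<lambda>t. G t * \<rho> t) - L\<bar> \<le> e"
proof -
  have int: "((\<lambda>t. G t * \<rho> t) has_integral integral I (\<lambda>t. G t * \<rho> t)) I"
    using has_integral_mult_smooth[OF G cd \<rho>(1,3)] by (metis has_integral_integrable integrable_integral)
  then show "(\<lambda>t. G t * \<rho> t) integrable_on I" by blast
  have "(\<rho> has_integral 1) I"
    by (rule has_integral_on_superset[OF \<rho>(4) \<rho>(3) cd(2)])
  then have k: "((\<lambda>t. k * \<rho> t) has_integral k) I" for k
    using has_integral_mult_right[of \<rho> 1 I k] by simp
  have "(L - e) * \<rho> t \<le> G t * \<rho> t \<and> G t * \<rho> t \<le> (L + e) * \<rho> t" for t
  proof (cases "t \<in> {c..d}")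
    case True
    from close[OF True] show ?thesis
      by (intro conjI mult_right_mono \<rho>) linarith+
  qed (simp add: \<rho>)
  then show "\<bar>integral I (\<lambda>t. G t * \<rho> t) - L\<bar> \<le> e"
    using has_integral_le[OF k int] has_integral_le[OF int k] by (metis abs_diff_le_iff diff_le_eq)
qed

text \<open>Testing \<open>G'\<close> with the difference of two smooth steps that rise just before \<open>s\<close> and just before \<open>t\<close>
  shows that the averages of \<open>G\<close> to the left of \<open>s\<close> and to the left of \<open>t\<close> agree.\<close>

lemma Dlc_constant_if_deriv_0:
  assumes I: "is_interval I" and G: "G \<in> Dlc I" and 0: "deriv_of I G = 0"
    and s: "s \<in> I" "\<not> is_min I s" and t: "t \<in> I" "\<not> is_min I t"
  shows "G s = G t"
proof -
  note Gint = Dlc_integrable[OF G]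
  have "\<bar>G s - G t\<bar> \<le> 2 * e" if "e > 0" for e
  proof -
    have step: "\<exists>c B \<rho>. c < r \<and> {c..r} \<subseteq> I \<and> smooth B \<and> smooth \<rho> \<and> (\<forall>x. (B has_real_derivative \<rho> x) (at x)) \<and>
      (\<forall>x\<le>c. B x = 0) \<and> (\<forall>x\<ge>r. B x = 1) \<and> (\<lambda>t. G t * \<rho> t) integrable_on I \<and>
      \<bar>integral I (\<lambda>t. G t * \<rho> t) - G r\<bar> \<le> e" if r: "r \<in> I" "\<not> is_min I r" for r
    proof -
      obtain c where c: "c < r" "{c..r} \<subseteq> I" "\<And>x. x \<in> {c..r} \<Longrightarrow> \<bar>G x - G r\<bar> < e"
        using Dlc_close_left[OF I G r \<open>e > 0\<close>] by blast
      obtain B \<rho> where B: "smooth B" "smooth \<rho>" "\<And>x. (B has_real_derivative \<rho> x) (at x)"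
        "\<And>x. 0 \<le> \<rho> x" "\<And>x. x \<notin> {c..r} \<Longrightarrow> \<rho> x = 0"
        "\<And>x. x \<le> c \<Longrightarrow> B x = 0" "\<And>x. r \<le> x \<Longrightarrow> B x = 1"
        using smooth_step_exists[OF c(1)] by blast
      have "(\<rho> has_integral B r - B c) {c..r}"
        using c(1) B(3) by (intro fundamental_theorem_of_calculus)
          (auto simp: has_real_derivative_iff_has_vector_derivative[symmetric] intro: has_field_derivative_at_within)
      then have "(\<rho> has_integral 1) {c..r}" using B(6,7) by simp
      with kernel_average_close[OF Gint _ c(2) _ B(2,4,5), of "G r" e] c B(1-3,6,7)
      show ?thesis by (intro exI[of _ c] exI[of _ B] exI[of _ \<rho>]) (auto intro: less_imp_le)
    qed
    obtain c B \<rho> where 1: "c < s" "{c..s} \<subseteq> I" "smooth B" "smooth \<rho>"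
      "\<And>x. (B has_real_derivative \<rho> x) (at x)" "\<And>x. x \<le> c \<Longrightarrow> B x = 0" "\<And>x. s \<le> x \<Longrightarrow> B x = 1"
      "(\<lambda>t. G t * \<rho> t) integrable_on I" "\<bar>integral I (\<lambda>t. G t * \<rho> t) - G s\<bar> \<le> e"
      using step[OF s] by blast
    obtain d C \<sigma> where 2: "d < t" "{d..t} \<subseteq> I" "smooth C" "smooth \<sigma>"
      "\<And>x. (C has_real_derivative \<sigma> x) (at x)" "\<And>x. x \<le> d \<Longrightarrow> C x = 0" "\<And>x. t \<le> x \<Longrightarrow> C x = 1"
      "(\<lambda>t. G t * \<sigma> t) integrable_on I" "\<bar>integral I (\<lambda>x. G x * \<sigma> x) - G t\<bar> \<le> e"
      using step[OF t] by blast
    \<comment> \<open>Beyond \<open>max s t\<close> both steps equal \<open>1\<close> and cancel, which makes the support compact.\<close>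
    define \<phi> where "\<phi> = B + (-1) *\<^sub>R C"
    have "min c d \<in> I" "max s t \<in> I"
      using 1(1,2) 2(1,2) s t by (auto simp: min_def max_def)
    then have "\<phi> \<in> test_functions I"
      unfolding test_functions_iff \<phi>_def using 1 2
      by (intro conjI smooth_add smooth_scaleR exI[of _ "{min c d..max s t}"] interval_subset I) auto
    moreover have "deriv \<phi> x = \<rho> x - \<sigma> x" for x
      unfolding \<phi>_def using 1(5)[of x] 2(5)[of x]
      by (intro DERIV_imp_deriv) (auto simp: plus_fun_def scaleR_fun_def intro!: derivative_eq_intros)
    ultimately have "integral I (\<lambda>x. G x * (\<rho> x - \<sigma> x)) = 0"
      using fun_cong[OF 0, of \<phi>] by (simp add: deriv_of_apply)
    then have "integral I (\<lambda>x. G x * \<rho> x) = integral I (\<lambda>x. G x * \<sigma> x)"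
      using integral_diff[OF 1(8) 2(8)] by (simp add: right_diff_distrib)
    then show ?thesis using 1(9) 2(9) by linarith
  qed
  from this[of "\<bar>G s - G t\<bar> / 3"] show ?thesis by (cases "G s = G t") auto
qed

text \<open>The constant value at the points other than the minimum is the limit at \<open>inf I\<close>.\<close>

lemma Dlc0_eq_0_if_deriv_0:
  assumes I: "is_interval I" "\<exists>a\<in>I. \<exists>b\<in>I. a < b" and G: "G \<in> Dlc0 I" and 0: "deriv_of I G = 0"
  shows "G = 0"
proof -
  have GD: "G \<in> Dlc I" "(G \<longlongrightarrow> 0) (inf_right I)" using G by (auto simp: Dlc0_def)
  have nonmin: "G t = 0" if t: "t \<in> I" "\<not> is_min I t" for t
  proof -
    have "eventually (\<lambda>s. G s = G t) (inf_right I)"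
      using inf_right_eventually[OF I]
      by eventually_elim (use Dlc_constant_if_deriv_0[OF I(1) GD(1) 0 _ _ t] in blast)
    then have "(G \<longlongrightarrow> G t) (inf_right I)" by (rule tendsto_eventually)
    then show ?thesis using GD(2) inf_right_neq_bot tendsto_unique by blast
  qed
  have "G t = 0" if "t \<in> I" for t
    using Dlc_nonneg_of_non_min[OF I GD(1) _ that] nonmin
      Dlc_nonneg_of_non_min[OF I subspace_neg[OF subspace_Dlc GD(1)] _ that]
    by (force intro: antisym)
  then show ?thesis using GD(1) by (auto simp: Dlc_def functions_on_def fun_eq_iff)
qed

theorem theorem3p6:
  fixes I :: "real set"
  assumes "is_interval I"
    and "\<exists>a\<in>I. \<exists>b\<in>I. a < b"
  shows "ordered_normed_space_on (Dlc I) (pointwise_le I) (alexiewicz_norm I) \<and>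
    ordered_normed_space_on (Dlc0 I) (pointwise_le I) (alexiewicz_norm I) \<and>
    ordered_normed_space_on (AD I) (AD_le I) (AD_norm I) \<and>
    linear_isometry_between (AD I) (AD_norm I) (Dlc0 I) (alexiewicz_norm I) (primitive I)"
proof -
  have ne: "I \<noteq> {}" using assms(2) by blast
  have int: "F integrable_on I" if "F \<in> Dlc0 I" for F
    using that Dlc0_subset_Dlc Dlc_integrable by blast
  have inj: "F = G" if "F \<in> Dlc0 I" "G \<in> Dlc0 I" "deriv_of I F = deriv_of I G" for F G
  proof -
    have "deriv_of I (F + (-1) *\<^sub>R G) = 0"
      using that deriv_of_add[OF assms(1) ne int int, of F "(-1) *\<^sub>R G"]
        subspace_scale[OF subspace_Dlc0 that(2), of "-1"] deriv_of_scaleR[of I "-1" G]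
      by simp
    moreover have "F + (-1) *\<^sub>R G \<in> Dlc0 I"
      using that by (intro subspace_add subspace_scale subspace_Dlc0)
    ultimately show "F = G" using Dlc0_eq_0_if_deriv_0[OF assms] by fastforce
  qed
  have AD: "AD I = deriv_of I ` Dlc0 I"
    using deriv_of_in_distributions[OF assms(1) ne int] by (auto simp: AD_def)
  have prim: "primitive I (deriv_of I F) = F" if "F \<in> Dlc0 I" for F
    unfolding primitive_def using that inj by (intro the_equality) auto
  have bij: "bij_betw (primitive I) (AD I) (Dlc0 I)"
    unfolding AD by (rule bij_betw_byWitness[where f' = "deriv_of I"]) (auto simp: prim)
  have sub: "F + G \<in> Dlc0 I" "c *\<^sub>R F \<in> Dlc0 I" if "F \<in> Dlc0 I" "G \<in> Dlc0 I" for F G c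
    using that subspace_Dlc0[of I] by (auto intro: subspace_add subspace_scale)
  have add: "primitive I (f + g) = primitive I f + primitive I g" if "f \<in> AD I" "g \<in> AD I" for f g
    using that unfolding AD
    by (auto simp: prim sub deriv_of_add[OF assms(1) ne int int, symmetric])
  have scale: "primitive I (c *\<^sub>R f) = c *\<^sub>R primitive I f" if "f \<in> AD I" for c f
    using that unfolding AD by (auto simp: prim sub deriv_of_scaleR[symmetric])
  have "subspace (AD I)"
    unfolding subspace_def
  proof (intro conjI ballI allI)
    show "0 \<in> AD I"
      unfolding AD using deriv_of_scaleR[of I 0 0] subspace_0[OF subspace_Dlc0] by (auto intro!: image_eqI[of _ _ 0])
    show "f + g \<in> AD I" if "f \<in> AD I" "g \<in> AD I" for f g
      using that sub unfolding AD by (auto simp: deriv_of_add[OF assms(1) ne int int, symmetric])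
    show "c *\<^sub>R f \<in> AD I" if "f \<in> AD I" for c f
      using that sub unfolding AD by (auto simp: deriv_of_scaleR[symmetric])
  qed
  have Dlc0: "ordered_normed_space_on (Dlc0 I) (pointwise_le I) (alexiewicz_norm I)"
    by (rule ordered_normed_space_on_subspace_Dlc[OF assms subspace_Dlc0 Dlc0_subset_Dlc])
  have "ordered_normed_space_on (AD I) (AD_le I) (AD_norm I)"
    unfolding AD_le_def[abs_def] AD_norm_def[abs_def]
    by (rule ordered_normed_space_on_linear_pullback[OF Dlc0 \<open>subspace (AD I)\<close> bij]) (fact add scale)+
  moreover have "linear_isometry_between (AD I) (AD_norm I) (Dlc0 I) (alexiewicz_norm I) (primitive I)"
    unfolding linear_isometry_between_def using bij add scale by (auto simp: AD_norm_def)
  moreover have "ordered_normed_space_on (Dlc I) (pointwise_le I) (alexiewicz_norm I)"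
    by (rule ordered_normed_space_on_subspace_Dlc[OF assms subspace_Dlc order_refl])
  ultimately show ?thesis using Dlc0 by blast
qed

end
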